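(* Let $\mathbb{K}$ be a field, let $G$ be a simple graph on $n$ vertices, let $R=\mathbb{K}[x_1,\dots,x_n,y_1,\dots,y_n]$, and let $f=y_1\,f_{12}\,f_{23}\cdots f_{n-1\,n}\,x_n\in R$, where $f_{ij}=x_iy_j-x_jy_i$. Then $G$ is weakly closed if and only if there exists a labeling of the vertices of $G$ by $1,\dots,n$ such that, with respect to this labeling, the binomial edge ideal $J_G$ is a Knutson ideal associated with $f$, i.e. $J_G\in\mathcal{C}_f$.
   Context: For a simple graph $G$ with vertices labeled by $[n]=\{1,\dots,n\}$ and edge set $E(G)$, the binomial edge ideal is $J_G=(f_{ij}=x_iy_j-x_jy_i \mid \{i,j\}\in E(G))\subseteq R$; it depends on the labeling. A simple graph $G$ on $n$ vertices is weakly closed if there exists a labeling of its vertices by $[n]$ such that for all integers $1\le i<j<k\le n$, if $\{i,k\}\in E(G)$ then $\{i,j\}\in E(G)$ or $\{j,k\}\in E(G)$. Knutson ideals: let $f$ be a polynomial in a polynomial ring $A$ over $\mathbb{K}$ whose leading term is a squarefree monomial for some term order (for $A=R=\mathbb{K}[x_1,\dots,x_n,y_1,\dots,y_n]$, $f=y_1\,f_{12}\,f_{23}\cdots f_{n-1\,n}\,x_n$ with $f_{ij}=x_iy_j-x_jy_i$, and a diagonal term order, the leading monomial is $\prod_{i=1}^n x_iy_i$). $\mathcal{C}_f$ is the smallest set of ideals of $A$ such that: (1) $(f)\in\mathcal{C}_f$; (2) if $I\in\mathcal{C}_f$ then $I:J\in\mathcal{C}_f$ for every ideal $J\subseteq A$;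 (3) if $I,J\in\mathcal{C}_f$ then $I+J\in\mathcal{C}_f$ and $I\cap J\in\mathcal{C}_f$. An ideal in $\mathcal{C}_f$ is called a Knutson ideal associated with $f$.
   Formalization: The graph G is assumed to have at least one edge: an edgeless graph is weakly closed, but its binomial edge ideal is (0), which is not in C_f because every Knutson ideal associated with f contains the nonzero polynomial f. *)

theory Defs
  imports "HOL-Algebra.Ideal" "HOL-Library.Poly_Mapping"
begin

section \<open>The polynomial ring in the variables x_1, ..., x_n, y_1, ..., y_n\<close>

datatype pvar = X nat | Y nat

text \<open>
  Polynomials over all variables \<open>X i\<close>, \<open>Y i\<close> with \<open>i :: nat\<close> are finitely supported maps from
  monomials (finitely supported exponent maps) to coefficients; the ring for a given \<open>n\<close> is cut
  out by its carrier, so that ideals and colon ideals are those of the ring in \<open>2 * n\<close> variables.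
\<close>

type_synonym 'k pol = "(pvar \<Rightarrow>\<^sub>0 nat) \<Rightarrow>\<^sub>0 'k"

definition var :: "pvar \<Rightarrow> 'k::comm_ring_1 pol" where
  "var v = Poly_Mapping.single (Poly_Mapping.single v 1) 1"

definition vars_of :: "'k::comm_ring_1 pol \<Rightarrow> pvar set" where
  "vars_of p = (\<Union>m \<in> Poly_Mapping.keys p. Poly_Mapping.keys m)"

definition poly_ring :: "nat \<Rightarrow> ('k::comm_ring_1 pol) ring" where
  "poly_ring n =
    \<lparr>carrier = {p. vars_of p \<subseteq> X ` {1..n} \<union> Y ` {1..n}},
     mult = (*), one = 1, zero = 0, add = (+)\<rparr>"

definition minor2 :: "nat \<Rightarrow> nat \<Rightarrow> 'k::comm_ring_1 pol" where
  "minor2 i j = var (X i) * var (Y j) - var (X j) * var (Y i)"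


section \<open>Graphs, labelings and binomial edge ideals\<close>

definition simple_graph :: "'v set \<Rightarrow> 'v set set \<Rightarrow> bool" where
  "simple_graph V E \<longleftrightarrow> finite V \<and> (\<forall>e\<in>E. e \<subseteq> V \<and> card e = 2)"

definition labeling :: "'v set \<Rightarrow> ('v \<Rightarrow> nat) \<Rightarrow> bool" where
  "labeling V l \<longleftrightarrow> bij_betw l V {1..card V}"

definition labeled_edges :: "('v \<Rightarrow> nat) \<Rightarrow> 'v set set \<Rightarrow> nat set set" where
  "labeled_edges l E = (\<lambda>e. l ` e) ` E"

definition weakly_closed :: "'v set \<Rightarrow> 'v set set \<Rightarrow> bool" where
  "weakly_closed V E \<longleftrightarrow>
    (\<exists>l. labeling V l \<and>
      (\<forall>i j k. 1 \<le> i \<and> i < j \<and> j < k \<and> k \<le> card V \<longrightarrow>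
        {i, k} \<in> labeled_edges l E \<longrightarrow>
        {i, j} \<in> labeled_edges l E \<or> {j, k} \<in> labeled_edges l E))"

text \<open>Both \<open>minor2 i j\<close> and \<open>minor2 j i = - minor2 i j\<close> occur as generators for an edge \<open>{i, j}\<close>.\<close>

definition binomial_edge_ideal :: "nat \<Rightarrow> nat set set \<Rightarrow> 'k::comm_ring_1 pol set" where
  "binomial_edge_ideal n E = Idl\<^bsub>poly_ring n\<^esub> {minor2 i j | i j. {i, j} \<in> E}"


section \<open>Knutson ideals\<close>

definition colon_ideal :: "('a, 'm) ring_scheme \<Rightarrow> 'a set \<Rightarrow> 'a set \<Rightarrow> 'a set" where
  "colon_ideal R I J = {a \<in> carrier R. \<forall>b\<in>J. a \<otimes>\<^bsub>R\<^esub> b \<in> I}"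

inductive_set knutson_ideals :: "('a, 'm) ring_scheme \<Rightarrow> 'a \<Rightarrow> 'a set set"
  for R (structure) and f where
  principal: "PIdl f \<in> knutson_ideals R f"
| colon: "I \<in> knutson_ideals R f \<Longrightarrow> ideal J R \<Longrightarrow> colon_ideal R I J \<in> knutson_ideals R f"
| sum: "I \<in> knutson_ideals R f \<Longrightarrow> J \<in> knutson_ideals R f \<Longrightarrow> I <+> J \<in> knutson_ideals R f"
| inter: "I \<in> knutson_ideals R f \<Longrightarrow> J \<in> knutson_ideals R f \<Longrightarrow> I \<inter> J \<in> knutson_ideals R f"

definition knutson_poly :: "nat \<Rightarrow> 'k::comm_ring_1 pol" where
  "knutson_poly n = var (Y 1) * (\<Prod>i = 1..<n. minor2 i (i + 1)) * var (X n)"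


section \<open>Basic facts\<close>

lemma vars_of_add: "vars_of (p + q) \<subseteq> vars_of p \<union> vars_of q"
  using Poly_Mapping.keys_add[of p q] unfolding vars_of_def by blast

lemma vars_of_uminus: "vars_of (- p) = vars_of p"
  unfolding vars_of_def by (simp add: Poly_Mapping.keys_def)

lemma vars_of_diff: "vars_of (p - q) \<subseteq> vars_of p \<union> vars_of q"
  using vars_of_add[of p "- q"] by (simp add: vars_of_uminus)

lemma vars_of_mult: "vars_of (p * q) \<subseteq> vars_of p \<union> vars_of q"
proof
  fix v assume "v \<in> vars_of (p * q)"
  then obtain m where m: "m \<in> Poly_Mapping.keys (p * q)" "v \<in> Poly_Mapping.keys m"
    unfolding vars_of_def by blast
  from m(1) obtain a b where ab: "m = a + b" "a \<in> Poly_Mapping.keys p" "b \<in> Poly_Mapping.keys q"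
    using keys_mult[of p q] by blast
  with m(2) have "v \<in> Poly_Mapping.keys a \<union> Poly_Mapping.keys b"
    using Poly_Mapping.keys_add[of a b] by blast
  with ab show "v \<in> vars_of p \<union> vars_of q"
    unfolding vars_of_def by blast
qed

lemma vars_of_zero [simp]: "vars_of 0 = {}"
  and vars_of_one [simp]: "vars_of 1 = {}"
  and vars_of_var [simp]: "vars_of (var v) = {v}"
  by (simp_all add: vars_of_def var_def)

lemma cring_poly_ring: "cring (poly_ring n :: ('k::comm_ring_1 pol) ring)"
proof (rule cringI)
  show "abelian_group (poly_ring n :: ('k pol) ring)"
  proof (rule abelian_groupI)
    fix p :: "'k pol" assume "p \<in> carrier (poly_ring n)"
    then show "\<exists>q \<in> carrier (poly_ring n). q \<oplus>\<^bsub>poly_ring n\<^esub> p = \<zero>\<^bsub>poly_ring n\<^esub>"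
      by (intro bexI[of _ "- p"]) (simp_all add: poly_ring_def vars_of_uminus)
  qed (use vars_of_add in \<open>force simp: poly_ring_def algebra_simps\<close>)+
  show "comm_monoid (poly_ring n :: ('k pol) ring)"
    by (rule comm_monoidI) (use vars_of_mult in \<open>force simp: poly_ring_def algebra_simps\<close>)+
qed (simp add: poly_ring_def algebra_simps)

lemma minor2_in_carrier:
  assumes "i \<in> {1..n}" "j \<in> {1..n}"
  shows "minor2 i j \<in> carrier (poly_ring n :: ('k::comm_ring_1 pol) ring)"
proof -
  have "vars_of (minor2 i j :: 'k pol) \<subseteq> {X i, X j, Y i, Y j}"
    unfolding minor2_def
    using vars_of_diff[of "var (X i) * var (Y j) :: 'k pol" "var (X j) * var (Y i)"]
      vars_of_mult[of "var (X i) :: 'k pol" "var (Y j)"]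
      vars_of_mult[of "var (X j) :: 'k pol" "var (Y i)"] by auto
  with assms show ?thesis
    by (auto simp: poly_ring_def)
qed

lemma knutson_poly_in_carrier:
  assumes "n \<ge> 1"
  shows "knutson_poly n \<in> carrier (poly_ring n :: ('k::comm_ring_1 pol) ring)"
proof -
  have mult: "p * q \<in> carrier (poly_ring n)"
    if "p \<in> carrier (poly_ring n)" "q \<in> carrier (poly_ring n)" for p q :: "'k pol"
    using that vars_of_mult[of p q] by (auto simp: poly_ring_def)
  have v: "var (Y 1) \<in> carrier (poly_ring n :: ('k pol) ring)"
    "var (X n) \<in> carrier (poly_ring n :: ('k pol) ring)"
    using assms by (auto simp: poly_ring_def)
  have "(\<Prod>i\<in>A. minor2 i (i + 1)) \<in> carrier (poly_ring n :: ('k pol) ring)" if "A \<subseteq> {1..<n}" for A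
  proof -
    from that have "finite A" by (rule finite_subset) simp
    then show ?thesis using that
    proof (induction A rule: finite_induct)
      case empty
      then show ?case by (simp add: poly_ring_def)
    next
      case (insert a A)
      then show ?case by (auto intro!: mult minor2_in_carrier)
    qed
  qed
  then show ?thesis
    unfolding knutson_poly_def by (intro mult v) simp
qed

text \<open>
  Every member of \<^term>\<open>knutson_ideals R f\<close> is an ideal that contains \<open>f\<close>. In particular the zero
  ideal, which is the binomial edge ideal of a graph without edges, is not a Knutson ideal
  associated with a nonzero \<open>f\<close>.
\<close>

lemma knutson_ideals_ideal:
  fixes R (structure)
  assumes R: "cring R" and f: "f \<in> carrier R" and I: "I \<in> knutson_ideals R f"
  shows "ideal I R" and "f \<in> I"
proof -
  interpret cring R by fact
  have "ideal I R \<and> f \<in> I"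
    using I
  proof (induction rule: knutson_ideals.induct)
    case principal
    then show ?case using cgenideal_ideal[OF f] cgenideal_self[OF f] by simp
  next
    case (colon I J)
    interpret I: ideal I R using colon by simp
    interpret J: ideal J R by fact
    have "ideal (colon_ideal R I J) R"
    proof (rule idealI)
      show "subgroup (colon_ideal R I J) (add_monoid R)"
      proof (rule add.subgroupI)
        have "f \<in> colon_ideal R I J"
          using f colon by (auto simp: colon_ideal_def intro!: I.I_r_closed intro: J.Icarr)
        then show "colon_ideal R I J \<noteq> {}" by blast
        show "\<ominus> a \<in> colon_ideal R I J" if "a \<in> colon_ideal R I J" for a
          using that by (auto simp: colon_ideal_def l_minus J.Icarr)
        show "a \<oplus> b \<in> colon_ideal R I J"
          if "a \<in> colon_ideal R I J" "b \<in> colon_ideal R I J" for a b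
          using that by (auto simp: colon_ideal_def l_distr J.Icarr)
      qed (auto simp: colon_ideal_def)
    next
      fix a x assume a: "a \<in> colon_ideal R I J" and x: "x \<in> carrier R"
      have ax: "x \<otimes> a \<otimes> b \<in> I" if "b \<in> J" for b
        using a x that I.I_l_closed[of "a \<otimes> b" x]
        by (auto simp: colon_ideal_def m_assoc J.Icarr)
      show "x \<otimes> a \<in> colon_ideal R I J"
        using a x ax by (auto simp: colon_ideal_def)
      then show "a \<otimes> x \<in> colon_ideal R I J"
        using a x by (simp add: colon_ideal_def m_comm)
    qed (rule ring_axioms)
    then show ?case
      using f colon by (auto simp: colon_ideal_def intro!: I.I_r_closed intro: J.Icarr)
  next
    case (sum I J)
    interpret J: ideal J R using sum by simp
    have "f \<oplus> \<zero> \<in> I <+> J"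
      using sum J.zero_closed unfolding set_add_def' by blast
    with sum f show ?case by (simp add: add_ideals)
  next
    case (inter I J)
    then show ?case by (auto intro: i_intersect)
  qed
  then show "ideal I R" and "f \<in> I" by simp_all
qed

end

theory Submission
  imports Defs
begin

text \<open>
Border the generic matrix with columns \<open>(x_i, y_i)\<close>, \<open>1 \<le> i \<le> n\<close>, by a column \<open>0\<close> equal to \<open>(1, 0)\<close> and a
column \<open>n + 1\<close> equal to \<open>(0, 1)\<close>. The polynomial \<open>f\<close> is then the product of the \<open>n + 1\<close> two-minors of
adjacent columns (\<open>knutson_poly_eq\<close>). For a set \<open>D\<close> of columns and a nonempty set \<open>S\<close> of cuts, where the
cut \<open>s\<close> separates the columns below \<open>s\<close> from the others, consider the matrices in which the columns
outside \<open>D\<close> vanish and the columns of \<open>D\<close>, together with the two border columns, are parallel unless some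
cut separates them. They have an obvious parametrization by free parameters, so the polynomials that vanish on the
generic such matrix form a prime ideal, \<open>config_prime n D S\<close>. The whole proof rests on the fact that the
Knutson ideals are exactly the intersections of families of nonzero primes of this kind, where the empty
family stands for the whole ring.

The tool is a \<open>K\<close>-basis of the polynomial ring, indexed by the monomials. A monomial \<open>m\<close> has a jump
\<open>(p, q)\<close> if \<open>x_p\<close> and \<open>y_q\<close> divide it (with \<open>x_0\<close> and \<open>y_(n+1)\<close> counted as divisors) and no variable of a
column strictly between \<open>p\<close> and \<open>q\<close> does; its basis element is obtained from \<open>m\<close> by replacing \<open>x_p y_q\<close> by
the minor of the columns \<open>p\<close> and \<open>q\<close>, for all jumps at once. Every configuration prime is spanned by the
basis elements that it contains (\<open>config_prime_adapted\<close>), because the images of the others under the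
parametrization have distinct leading monomials. Moreover each basis element avoids a largest
configuration prime, the one given by the columns and the jumps of \<open>m\<close> (\<open>config_prime_least\<close>). With these two
facts the class of intersections of configuration primes is closed under sums; it is closed under
colon ideals since the primes are prime, and under intersections trivially, and it contains \<open>(f)\<close>.
This gives \<open>knutson_separated\<close>. Conversely, the nonzero configuration primes are built from \<open>(f)\<close> by colons and
sums (\<open>config_prime_knutson\<close>); there are finitely many of them.

If \<open>J_G\<close> is Knutson, but \<open>{i, k}\<close> is an edge and \<open>{i, j}\<close>, \<open>{j, k}\<close> are not for some \<open>i < j < k\<close>, then
\<open>x_k f_ij\<close> is not in \<open>J_G\<close>, hence avoids a configuration prime containing \<open>J_G\<close>. In that configuration
columns \<open>i\<close> and \<open>k\<close> are present and a cut separates \<open>i\<close> from \<open>j\<close>, hence \<open>i\<close> from \<open>k\<close>, so \<open>f_ik\<close> does not vanish on it: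
a contradiction. If the labeling is weakly closed, then a basis element whose largest prime does not
contain \<open>J_G\<close> has a jump inside some edge \<open>{i, k}\<close> between two of its columns; taking the shortest
such edge, three-term relations between minors show that the basis element lies in \<open>J_G\<close>
(\<open>basis_elem_in_edge_ideal\<close>). Therefore \<open>J_G\<close> is the intersection of the configuration primes
above it, and these are nonzero because \<open>G\<close> has an edge.
\<close>


section \<open>Top monomials\<close>

lemma keys_add_nat: "Poly_Mapping.keys (a + b) = Poly_Mapping.keys a \<union> Poly_Mapping.keys (b :: 'a \<Rightarrow>\<^sub>0 nat)"
  by (auto simp: in_keys_iff lookup_add)

lemma lookup_of_nat_mult:
  "Poly_Mapping.lookup (of_nat k * p) t = k * Poly_Mapping.lookup (p :: nat \<Rightarrow>\<^sub>0 nat) t"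
proof -
  have "of_nat k * p = Poly_Mapping.map ((*) k) p"
    by (metis mult_map_scale_conv_mult of_nat_id single_of_nat)
  then show ?thesis
    by (simp add: Poly_Mapping.map.rep_eq when_def)
qed

definition weight :: "('a \<Rightarrow> nat) \<Rightarrow> ('a \<Rightarrow>\<^sub>0 nat) \<Rightarrow> nat" where
  "weight w m = (\<Sum>v\<in>Poly_Mapping.keys m. Poly_Mapping.lookup m v * w v)"

lemma weight_superset:
  assumes "finite A" "Poly_Mapping.keys m \<subseteq> A"
  shows "weight w m = (\<Sum>v\<in>A. Poly_Mapping.lookup m v * w v)"
  unfolding weight_def using assms
  by (intro sum.mono_neutral_left) (auto simp: in_keys_iff)

lemma weight_add: "weight w (a + b) = weight w a + weight w b"
proof -
  let ?A = "Poly_Mapping.keys a \<union> Poly_Mapping.keys b"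
  have "weight w (a + b) = (\<Sum>v\<in>?A. Poly_Mapping.lookup (a + b) v * w v)"
    "weight w a = (\<Sum>v\<in>?A. Poly_Mapping.lookup a v * w v)"
    "weight w b = (\<Sum>v\<in>?A. Poly_Mapping.lookup b v * w v)"
    by (intro weight_superset; simp add: keys_add_nat)+
  then show ?thesis
    by (simp add: lookup_add sum.distrib algebra_simps)
qed

lemma weight_zero [simp]: "weight w 0 = 0"
  by (simp add: weight_def)

lemma weight_single [simp]: "weight w (Poly_Mapping.single v k) = k * w v"
  by (cases "k = 0") (simp_all add: weight_def)

text \<open>
The coefficient of the top monomial is required to be \<open>1\<close>, and every other monomial has strictly
smaller weight. No term order is needed: weights separate the two terms of each minor that occurs.
\<close>

definition has_top :: "('a \<Rightarrow> nat) \<Rightarrow> (('a \<Rightarrow>\<^sub>0 nat) \<Rightarrow>\<^sub>0 'k::comm_ring_1) \<Rightarrow> ('a \<Rightarrow>\<^sub>0 nat) \<Rightarrow> bool" where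
  "has_top w P L \<longleftrightarrow> (\<forall>k\<in>Poly_Mapping.keys (P - Poly_Mapping.single L 1). weight w k < weight w L)"

lemma has_top_single: "has_top w (Poly_Mapping.single L 1) L"
  by (simp add: has_top_def)

lemma has_top_one: "has_top w 1 0"
  using has_top_single[of w 0] by simp

lemma has_top_diff_single:
  assumes "weight w k < weight w L"
  shows "has_top w (Poly_Mapping.single L 1 - Poly_Mapping.single k c) L"
proof -
  have "Poly_Mapping.keys (Poly_Mapping.single L 1 - Poly_Mapping.single k c - Poly_Mapping.single L 1) \<subseteq> {k}"
    by (auto simp: in_keys_iff lookup_minus lookup_single when_def split: if_splits)
  then show ?thesis using assms by (auto simp: has_top_def)
qed

lemma has_top_mult:
  fixes P P' :: "('a \<Rightarrow>\<^sub>0 nat) \<Rightarrow>\<^sub>0 'k::comm_ring_1"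
  assumes "has_top w P L" "has_top w P' L'"
  shows "has_top w (P * P') (L + L')"
proof -
  define q q' where "q = P - Poly_Mapping.single L 1" and "q' = P' - Poly_Mapping.single L' 1"
  have q: "weight w k < weight w L" if "k \<in> Poly_Mapping.keys q" for k
    using assms(1) that by (auto simp: has_top_def q_def)
  have q': "weight w k < weight w L'" if "k \<in> Poly_Mapping.keys q'" for k
    using assms(2) that by (auto simp: has_top_def q'_def)
  have eq: "P * P' - Poly_Mapping.single (L + L') 1
      = q * q' + (Poly_Mapping.single L 1 * q' + q * Poly_Mapping.single L' 1)"
    by (simp add: q_def q'_def algebra_simps mult_single)
  have prod: "weight w k < weight w L + weight w L'"
    if "k \<in> Poly_Mapping.keys (A * B)"
      and "\<And>a b. a \<in> Poly_Mapping.keys A \<Longrightarrow> b \<in> Poly_Mapping.keys B \<Longrightarrow> weight w a + weight w b < weight w L + weight w L'"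
    for k and A B :: "('a \<Rightarrow>\<^sub>0 nat) \<Rightarrow>\<^sub>0 'k"
    using that keys_mult[of A B] by (force simp: weight_add)
  have "weight w k < weight w L + weight w L'"
    if k: "k \<in> Poly_Mapping.keys (P * P' - Poly_Mapping.single (L + L') 1)" for k
  proof -
    consider "k \<in> Poly_Mapping.keys (q * q')" | "k \<in> Poly_Mapping.keys (Poly_Mapping.single L 1 * q')"
      | "k \<in> Poly_Mapping.keys (q * Poly_Mapping.single L' 1)"
      using k unfolding eq
      using Poly_Mapping.keys_add[of "q * q'" "Poly_Mapping.single L 1 * q' + q * Poly_Mapping.single L' 1"]
        Poly_Mapping.keys_add[of "Poly_Mapping.single L 1 * q'" "q * Poly_Mapping.single L' 1"] by blast
    then show ?thesis
      by cases (rule prod, assumption, auto dest!: q q' split: if_splits)+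
  qed
  then show ?thesis by (auto simp: has_top_def weight_add)
qed

lemma has_top_prod:
  assumes "finite A" "\<And>a. a \<in> A \<Longrightarrow> has_top w (P a) (L a)"
  shows "has_top w (\<Prod>a\<in>A. P a) (\<Sum>a\<in>A. L a)"
  using assms by (induction A rule: finite_induct) (auto simp: has_top_one intro: has_top_mult)

lemma has_top_lookup:
  assumes "has_top w P L"
  shows "Poly_Mapping.lookup P L = 1"
    and "Poly_Mapping.lookup P k \<noteq> 0 \<Longrightarrow> k \<noteq> L \<Longrightarrow> weight w k < weight w L"
proof -
  have "L \<notin> Poly_Mapping.keys (P - Poly_Mapping.single L 1)"
    using assms by (auto simp: has_top_def)
  then show "Poly_Mapping.lookup P L = 1"
    by (simp add: in_keys_iff lookup_minus)
  show "weight w k < weight w L" if "Poly_Mapping.lookup P k \<noteq> 0" "k \<noteq> L"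
    using assms that by (auto simp: has_top_def in_keys_iff lookup_minus lookup_single when_def)
qed

text \<open>
Among the terms with nonzero coefficient choose one whose top monomial is heaviest; no other term
can cancel that monomial.
\<close>

lemma tops_independent:
  fixes P :: "'b \<Rightarrow> ('a \<Rightarrow>\<^sub>0 nat) \<Rightarrow>\<^sub>0 'k::comm_ring_1"
  assumes "finite T" and top: "\<And>m. m \<in> T \<Longrightarrow> has_top w (P m) (L m)" and inj: "inj_on L T"
    and sum: "(\<Sum>m\<in>T. Poly_Mapping.single 0 (c m) * P m) = 0" and "m \<in> T"
  shows "c m = 0"
proof (rule ccontr)
  assume "c m \<noteq> 0"
  define U where "U = {m\<in>T. c m \<noteq> 0}"
  have U: "finite U" "U \<noteq> {}" using \<open>finite T\<close> \<open>m \<in> T\<close> \<open>c m \<noteq> 0\<close> by (auto simp: U_def)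
  define N where "N = Max ((\<lambda>m. weight w (L m)) ` U)"
  have "N \<in> (\<lambda>m. weight w (L m)) ` U" unfolding N_def using U by (intro Max_in) auto
  then obtain a where a: "a \<in> U" "weight w (L a) = N" by auto
  have le: "weight w (L b) \<le> weight w (L a)" if "b \<in> U" for b
    using that U a(2) unfolding N_def by auto
  have "Poly_Mapping.lookup (Poly_Mapping.single 0 (c b) * P b) (L a) = (if b = a then c a else 0)"
    if "b \<in> T" for b
  proof -
    have *: "Poly_Mapping.lookup (Poly_Mapping.single 0 (c b) * P b) (L a) = c b * Poly_Mapping.lookup (P b) (L a)"
      by (simp flip: mult_map_scale_conv_mult add: Poly_Mapping.map.rep_eq when_def)
    show ?thesis
    proof (cases "b = a")
      case True
      then show ?thesis using * has_top_lookup(1)[OF top[OF that]] by simp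
    next
      case False
      then have ne: "L a \<noteq> L b" using inj that a(1) by (auto simp: inj_on_def U_def)
      have "Poly_Mapping.lookup (P b) (L a) = 0" if "c b \<noteq> 0"
        using has_top_lookup(2)[OF top[OF \<open>b \<in> T\<close>], of "L a"] ne le[of b] \<open>b \<in> T\<close> that
        by (auto simp: U_def)
      then show ?thesis using False * by (cases "c b = 0") simp_all
    qed
  qed
  then have "Poly_Mapping.lookup (\<Sum>m\<in>T. Poly_Mapping.single 0 (c m) * P m) (L a) = (\<Sum>b\<in>T. if b = a then c a else 0)"
    by (simp add: lookup_sum)
  also have "\<dots> = c a" using \<open>finite T\<close> a(1) by (simp add: U_def)
  finally show False using sum a(1) by (simp add: U_def)
qed


section \<open>Homomorphisms sending variables to monomials or zero\<close>

definition monomial_image :: "('a \<Rightarrow> (nat \<Rightarrow>\<^sub>0 nat)) \<Rightarrow> ('a \<Rightarrow>\<^sub>0 nat) \<Rightarrow> (nat \<Rightarrow>\<^sub>0 nat)" where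
  "monomial_image e m = (\<Sum>v\<in>Poly_Mapping.keys m. of_nat (Poly_Mapping.lookup m v) * e v)"

lemma monomial_image_superset:
  assumes "finite A" "Poly_Mapping.keys m \<subseteq> A"
  shows "monomial_image e m = (\<Sum>v\<in>A. of_nat (Poly_Mapping.lookup m v) * e v)"
  unfolding monomial_image_def using assms
  by (intro sum.mono_neutral_left) (auto simp: in_keys_iff)

lemma monomial_image_add: "monomial_image e (a + b) = monomial_image e a + monomial_image e b"
proof -
  let ?A = "Poly_Mapping.keys a \<union> Poly_Mapping.keys b"
  have "monomial_image e (a + b) = (\<Sum>v\<in>?A. of_nat (Poly_Mapping.lookup (a + b) v) * e v)"
    "monomial_image e a = (\<Sum>v\<in>?A. of_nat (Poly_Mapping.lookup a v) * e v)"
    "monomial_image e b = (\<Sum>v\<in>?A. of_nat (Poly_Mapping.lookup b v) * e v)"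
    by (intro monomial_image_superset; simp add: keys_add_nat)+
  then show ?thesis
    by (simp add: lookup_add sum.distrib algebra_simps)
qed

lemma monomial_image_zero [simp]: "monomial_image e 0 = 0"
  by (simp add: monomial_image_def)

lemma monomial_image_var [simp]: "monomial_image e (Poly_Mapping.single v (Suc 0)) = e v"
  by (simp add: monomial_image_def)

lemma monomial_image_sum: "monomial_image e (\<Sum>a\<in>A. m a) = (\<Sum>a\<in>A. monomial_image e (m a))"
  by (induction A rule: infinite_finite_induct) (auto simp: monomial_image_add)

text \<open>
The substitution of the monomial \<open>e v\<close> for each variable \<open>v\<close> outside \<open>K\<close>, and of \<open>0\<close> for the variables in \<open>K\<close>.
The target variables are indexed by numbers because polynomials over a linearly ordered set of
variables are known to form a domain.
\<close>

definition monomial_hom :: "'a set \<Rightarrow> ('a \<Rightarrow> (nat \<Rightarrow>\<^sub>0 nat)) \<Rightarrow> (('a \<Rightarrow>\<^sub>0 nat) \<Rightarrow>\<^sub>0 'k::comm_ring_1)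
    \<Rightarrow> ((nat \<Rightarrow>\<^sub>0 nat) \<Rightarrow>\<^sub>0 'k)" where
  "monomial_hom K e p = (\<Sum>m\<in>Poly_Mapping.keys p.
     if Poly_Mapping.keys m \<inter> K = {} then Poly_Mapping.single (monomial_image e m) (Poly_Mapping.lookup p m) else 0)"

lemma monomial_hom_superset:
  assumes "finite A" "Poly_Mapping.keys p \<subseteq> A"
  shows "monomial_hom K e p = (\<Sum>m\<in>A.
     if Poly_Mapping.keys m \<inter> K = {} then Poly_Mapping.single (monomial_image e m) (Poly_Mapping.lookup p m) else 0)"
  unfolding monomial_hom_def using assms
  by (intro sum.mono_neutral_left) (auto simp: in_keys_iff)

lemma monomial_hom_add: "monomial_hom K e (p + q) = monomial_hom K e p + monomial_hom K e q"
proof -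
  let ?A = "Poly_Mapping.keys p \<union> Poly_Mapping.keys q"
  have "monomial_hom K e r = (\<Sum>m\<in>?A. if Poly_Mapping.keys m \<inter> K = {}
        then Poly_Mapping.single (monomial_image e m) (Poly_Mapping.lookup r m) else 0)"
    if "Poly_Mapping.keys r \<subseteq> ?A" for r
    using that by (intro monomial_hom_superset) auto
  from this[of p] this[of q] this[of "p + q"] show ?thesis
    using Poly_Mapping.keys_add[of p q]
    by (auto simp: lookup_add single_add simp flip: sum.distrib intro!: sum.cong)
qed

lemma monomial_hom_zero [simp]: "monomial_hom K e 0 = 0"
  by (simp add: monomial_hom_def)

lemma monomial_hom_sum: "monomial_hom K e (\<Sum>a\<in>A. p a) = (\<Sum>a\<in>A. monomial_hom K e (p a))"
  by (induction A rule: infinite_finite_induct) (auto simp: monomial_hom_add)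

lemma monomial_hom_uminus: "monomial_hom K e (- p) = - monomial_hom K e p"
  using monomial_hom_add[of K e p "- p"] by (simp add: minus_unique)

lemma monomial_hom_diff: "monomial_hom K e (p - q) = monomial_hom K e p - monomial_hom K e q"
  using monomial_hom_add[of K e p "- q"] by (simp add: monomial_hom_uminus)

lemma monomial_hom_single:
  "monomial_hom K e (Poly_Mapping.single m a) =
    (if Poly_Mapping.keys m \<inter> K = {} then Poly_Mapping.single (monomial_image e m) a else 0)"
  by (cases "a = 0") (simp_all add: monomial_hom_def)

lemma poly_eq_sum_single:
  "p = (\<Sum>m\<in>Poly_Mapping.keys p. Poly_Mapping.single m (Poly_Mapping.lookup p m))"
proof (rule poly_mapping_eqI)
  fix k
  show "Poly_Mapping.lookup p k =
    Poly_Mapping.lookup (\<Sum>m\<in>Poly_Mapping.keys p. Poly_Mapping.single m (Poly_Mapping.lookup p m)) k"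
    by (cases "k \<in> Poly_Mapping.keys p") (auto simp: lookup_sum lookup_single when_def in_keys_iff)
qed

lemma monomial_hom_mult: "monomial_hom K e (p * q) = monomial_hom K e p * monomial_hom K e q"
proof -
  have s: "monomial_hom K e (Poly_Mapping.single a c * Poly_Mapping.single b d) =
     monomial_hom K e (Poly_Mapping.single a c) * monomial_hom K e (Poly_Mapping.single b d)" for a b c d
    by (simp add: mult_single monomial_hom_single monomial_image_add keys_add_nat Int_Un_distrib2)
  have "monomial_hom K e ((\<Sum>a\<in>A. Poly_Mapping.single a (f a)) * (\<Sum>b\<in>B. Poly_Mapping.single b (g b)))
      = monomial_hom K e (\<Sum>a\<in>A. Poly_Mapping.single a (f a)) * monomial_hom K e (\<Sum>b\<in>B. Poly_Mapping.single b (g b))"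
    for A B f g
    by (simp add: sum_product monomial_hom_sum s)
  from this[of "Poly_Mapping.lookup p" "Poly_Mapping.keys p" "Poly_Mapping.lookup q" "Poly_Mapping.keys q"]
  show ?thesis
    by (simp flip: poly_eq_sum_single)
qed

lemma monomial_hom_one [simp]: "monomial_hom K e 1 = 1"
  using monomial_hom_single[of K e 0 1] by simp

lemma monomial_hom_prod: "monomial_hom K e (\<Prod>a\<in>A. p a) = (\<Prod>a\<in>A. monomial_hom K e (p a))"
  by (induction A rule: infinite_finite_induct) (auto simp: monomial_hom_mult)


section \<open>The polynomial ring and its ideals\<close>

definition mons :: "nat \<Rightarrow> (pvar \<Rightarrow>\<^sub>0 nat) set" where
  "mons n = {m. Poly_Mapping.keys m \<subseteq> X ` {1..n} \<union> Y ` {1..n}}"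

abbreviation pols :: "nat \<Rightarrow> 'k::comm_ring_1 pol set" where
  "pols n \<equiv> carrier (poly_ring n)"

lemma pols_iff: "p \<in> pols n \<longleftrightarrow> Poly_Mapping.keys p \<subseteq> mons n"
  by (auto simp: poly_ring_def vars_of_def mons_def)

lemma poly_ring_simps [simp]:
  "mult (poly_ring n) = (*)" "add (poly_ring n) = (+)" "zero (poly_ring n) = 0" "one (poly_ring n) = 1"
  by (simp_all add: poly_ring_def)

lemma pols_add [intro]: "p \<in> pols n \<Longrightarrow> q \<in> pols n \<Longrightarrow> p + q \<in> pols n"
  using vars_of_add[of p q] by (auto simp: poly_ring_def)

lemma pols_diff [intro]: "p \<in> pols n \<Longrightarrow> q \<in> pols n \<Longrightarrow> p - q \<in> pols n"
  using vars_of_diff[of p q] by (auto simp: poly_ring_def)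

lemma pols_mult [intro]: "p \<in> pols n \<Longrightarrow> q \<in> pols n \<Longrightarrow> p * q \<in> pols n"
  using vars_of_mult[of p q] by (auto simp: poly_ring_def)

lemma pols_uminus [intro]: "p \<in> pols n \<Longrightarrow> - p \<in> pols n"
  by (auto simp: poly_ring_def vars_of_uminus)

lemma pols_zero [simp]: "0 \<in> pols n" and pols_one [simp]: "1 \<in> pols n"
  by (auto simp: poly_ring_def)

lemma pols_prod: "(\<And>a. a \<in> A \<Longrightarrow> p a \<in> pols n) \<Longrightarrow> (\<Prod>a\<in>A. p a) \<in> pols n"
  by (induction A rule: infinite_finite_induct) auto

lemma mons_zero [simp]: "0 \<in> mons n"
  by (simp add: mons_def)

lemma pols_single: "m \<in> mons n \<Longrightarrow> Poly_Mapping.single m a \<in> pols n"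
  by (auto simp: pols_iff)

lemma pols_const [simp]: "Poly_Mapping.single 0 a \<in> pols n"
  by (rule pols_single) simp

lemma var_pols: "i \<in> {1..n} \<Longrightarrow> var (X i) \<in> pols n" "i \<in> {1..n} \<Longrightarrow> var (Y i) \<in> pols n"
  by (auto simp: poly_ring_def)

lemma ideal_pols:
  assumes "ideal I (poly_ring n)"
  shows "I \<subseteq> pols n" "0 \<in> I" "a \<in> I \<Longrightarrow> b \<in> I \<Longrightarrow> a + b \<in> I"
    "a \<in> I \<Longrightarrow> b \<in> I \<Longrightarrow> a - b \<in> I"
    "r \<in> pols n \<Longrightarrow> a \<in> I \<Longrightarrow> r * a \<in> I" "r \<in> pols n \<Longrightarrow> a \<in> I \<Longrightarrow> a * r \<in> I"
proof -
  show "I \<subseteq> pols n" by (auto intro: ideal.Icarr[OF assms])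
  show "0 \<in> I" using additive_subgroup.zero_closed[OF ideal.axioms(1)[OF assms]] by simp
  show plus: "a + b \<in> I" if "a \<in> I" "b \<in> I" for a b
    using additive_subgroup.a_closed[OF ideal.axioms(1)[OF assms] that] by simp
  show mul: "r * a \<in> I" if "r \<in> pols n" "a \<in> I" for r a
    using ideal.I_l_closed[OF assms that(2,1)] by simp
  show "a * r \<in> I" if "r \<in> pols n" "a \<in> I" for r a
    using ideal.I_r_closed[OF assms that(2,1)] by simp
  show "a - b \<in> I" if "a \<in> I" "b \<in> I"
    using plus[OF that(1) mul[OF pols_uminus[OF pols_one] that(2)]] by simp
qed

lemma ideal_polsI:
  assumes "I \<subseteq> pols n" "0 \<in> I" "\<And>a b. a \<in> I \<Longrightarrow> b \<in> I \<Longrightarrow> a + b \<in> I"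
    "\<And>r a. r \<in> pols n \<Longrightarrow> a \<in> I \<Longrightarrow> r * a \<in> I"
  shows "ideal I (poly_ring n)"
proof (rule idealI)
  interpret cring "poly_ring n :: ('a pol) ring" by (rule cring_poly_ring)
  show "Ring.ring (poly_ring n :: ('a pol) ring)" by (rule ring_axioms)
  show "subgroup I (add_monoid (poly_ring n))"
  proof (rule add.subgroupI)
    fix a assume a: "a \<in> I"
    have "\<ominus>\<^bsub>poly_ring n\<^esub> a = - a"
      using a assms(1) by (intro minus_equality) auto
    then show "\<ominus>\<^bsub>poly_ring n\<^esub> a \<in> I"
      using assms(4)[OF pols_uminus[OF pols_one] a] by simp
  qed (use assms in auto)
  show "x \<otimes>\<^bsub>poly_ring n\<^esub> a \<in> I" "a \<otimes>\<^bsub>poly_ring n\<^esub> x \<in> I" if "a \<in> I" "x \<in> pols n" for a x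
    using assms(4)[OF that(2,1)] by (simp_all add: mult.commute)
qed

lemma ideal_sum:
  assumes "ideal I (poly_ring n)" "\<And>a. a \<in> A \<Longrightarrow> p a \<in> I"
  shows "(\<Sum>a\<in>A. p a) \<in> I"
  using assms(2) by (induction A rule: infinite_finite_induct) (auto intro: ideal_pols[OF assms(1)])

lemma colon_elem_ideal:
  assumes "ideal L (poly_ring n)" "g \<in> pols n"
  shows "ideal {a \<in> pols n. a * g \<in> L} (poly_ring n)"
  using ideal_pols[OF assms(1)] assms(2)
  by (intro ideal_polsI) (auto simp: distrib_right mult.assoc)


section \<open>Jumps of a monomial\<close>

text \<open>
The border columns count as present in every monomial: column \<open>0\<close> through its first entry, column
\<open>n + 1\<close> through its second one.
\<close>

definition has_x :: "(pvar \<Rightarrow>\<^sub>0 nat) \<Rightarrow> nat \<Rightarrow> bool" where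
  "has_x m i \<longleftrightarrow> i = 0 \<or> X i \<in> Poly_Mapping.keys m"

definition has_y :: "nat \<Rightarrow> (pvar \<Rightarrow>\<^sub>0 nat) \<Rightarrow> nat \<Rightarrow> bool" where
  "has_y n m i \<longleftrightarrow> i = n + 1 \<or> Y i \<in> Poly_Mapping.keys m"

definition jumps :: "nat \<Rightarrow> (pvar \<Rightarrow>\<^sub>0 nat) \<Rightarrow> (nat \<times> nat) set" where
  "jumps n m = {(p, q). p < q \<and> has_x m p \<and> has_y n m q \<and>
     (\<forall>s. p < s \<and> s < q \<longrightarrow> \<not> has_x m s \<and> \<not> has_y n m s)}"

definition cols :: "(pvar \<Rightarrow>\<^sub>0 nat) \<Rightarrow> nat set" where
  "cols m = {i. X i \<in> Poly_Mapping.keys m \<or> Y i \<in> Poly_Mapping.keys m}"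

lemma cols_mons: "m \<in> mons n \<Longrightarrow> cols m \<subseteq> {1..n}"
  by (auto simp: cols_def mons_def)

lemma mons_keys:
  assumes "m \<in> mons n"
  shows "X i \<in> Poly_Mapping.keys m \<Longrightarrow> i \<in> {1..n}" "Y i \<in> Poly_Mapping.keys m \<Longrightarrow> i \<in> {1..n}"
  using cols_mons[OF assms] by (auto simp: cols_def)

text \<open>
On the way from an \<open>X\<close>-variable to a \<open>Y\<close>-variable further right, somewhere an \<open>X\<close>-variable is followed
by a \<open>Y\<close>-variable in the next column that occurs.
\<close>

lemma jumps_between:
  assumes "has_x m i" "has_y n m j" "i < j"
  shows "\<exists>p q. (p, q) \<in> jumps n m \<and> i \<le> p \<and> q \<le> j"
  using assms
proof (induction "j - i" arbitrary: i j rule: less_induct)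
  case less
  show ?case
  proof (cases "\<exists>s. i < s \<and> s < j \<and> (has_x m s \<or> has_y n m s)")
    case False
    then have "(i, j) \<in> jumps n m" using less.prems by (auto simp: jumps_def)
    then show ?thesis by blast
  next
    case True
    then obtain s where s: "i < s" "s < j" "has_x m s \<or> has_y n m s" by blast
    from s(3) show ?thesis
    proof
      assume "has_x m s"
      then show ?thesis using less.hyps[of j s] less.prems s(1,2) by fastforce
    next
      assume "has_y n m s"
      then show ?thesis using less.hyps[of s i] less.prems s(1,2) by fastforce
    qed
  qed
qed

lemma jumps_D:
  assumes "m \<in> mons n" "(p, q) \<in> jumps n m"
  shows "p < q" "q \<le> n + 1" "p \<in> cols m \<union> {0}" "q \<in> cols m \<union> {n + 1}"
    "\<And>s. s \<in> cols m \<Longrightarrow> \<not> (p < s \<and> s < q)"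
  using assms(2) mons_keys[OF assms(1)] by (force simp: jumps_def has_x_def has_y_def cols_def)+

lemma jumps_left_unique:
  assumes "(p, q) \<in> jumps n m" "(p, q') \<in> jumps n m"
  shows "q = q'"
proof -
  have "\<not> s < t" if "(p, s) \<in> jumps n m" "(p, t) \<in> jumps n m" for s t
    using that unfolding jumps_def by blast
  from this[OF assms] this[OF assms(2,1)] show ?thesis by linarith
qed

lemma jumps_right_unique:
  assumes "(p, q) \<in> jumps n m" "(p', q) \<in> jumps n m"
  shows "p = p'"
proof -
  have "\<not> s < t" if "(s, q) \<in> jumps n m" "(t, q) \<in> jumps n m" for s t
    using that unfolding jumps_def by blast
  from this[OF assms] this[OF assms(2,1)] show ?thesis by linarith
qed

lemma finite_jumps:
  assumes "m \<in> mons n"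
  shows "finite (jumps n m)"
proof (rule finite_subset)
  show "jumps n m \<subseteq> {..n+1} \<times> {..n+1}"
  proof
    fix pq assume "pq \<in> jumps n m"
    moreover obtain p q where "pq = (p, q)" by (cases pq)
    ultimately show "pq \<in> {..n+1} \<times> {..n+1}"
      using jumps_D(1,2)[OF assms, of p q] by simp
  qed
qed simp

lemma jumps_bound: "m \<in> mons n \<Longrightarrow> jumps n m \<subseteq> {..n+1} \<times> {..n+1}"
  using jumps_D(1,2) by fastforce

definition lead_x :: "nat \<Rightarrow> (pvar \<Rightarrow>\<^sub>0 nat)" where
  "lead_x p = (if p = 0 then 0 else Poly_Mapping.single (X p) 1)"

definition lead_y :: "nat \<Rightarrow> nat \<Rightarrow> (pvar \<Rightarrow>\<^sub>0 nat)" where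
  "lead_y n q = (if q = n + 1 then 0 else Poly_Mapping.single (Y q) 1)"

definition jump_lead :: "nat \<Rightarrow> (pvar \<Rightarrow>\<^sub>0 nat) \<Rightarrow> (pvar \<Rightarrow>\<^sub>0 nat)" where
  "jump_lead n m = (\<Sum>(p, q)\<in>jumps n m. lead_x p + lead_y n q)"

text \<open>
A column is the left end of at most one jump and the right end of at most one, so the leading
monomials of the minors can be split off from \<open>m\<close> simultaneously.
\<close>

lemma lookup_jump_lead_le:
  assumes m: "m \<in> mons n"
  shows "Poly_Mapping.lookup (jump_lead n m) v \<le> Poly_Mapping.lookup m v"
proof -
  note fin = finite_jumps[OF m]
  have has_xD: "i = 0 \<or> X i \<in> Poly_Mapping.keys m" if "(i, q) \<in> jumps n m" for i q
    using that by (auto simp: jumps_def has_x_def)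
  have has_yD: "i = n + 1 \<or> Y i \<in> Poly_Mapping.keys m" if "(p, i) \<in> jumps n m" for i p
    using that by (auto simp: jumps_def has_y_def)
  obtain B where B: "\<And>p q. (p, q) \<in> jumps n m \<Longrightarrow>
      Poly_Mapping.lookup (lead_x p + lead_y n q) v = (if B p q then 1 else 0)"
    and uniq: "\<And>p q p' q'. (p, q) \<in> jumps n m \<Longrightarrow> B p q \<Longrightarrow> (p', q') \<in> jumps n m \<Longrightarrow> B p' q' \<Longrightarrow> p = p' \<and> q = q'"
    and keyB: "\<And>p q. (p, q) \<in> jumps n m \<Longrightarrow> B p q \<Longrightarrow> v \<in> Poly_Mapping.keys m"
  proof (cases v)
    case (X i)
    show ?thesis
      by (rule that[of "\<lambda>p q. p = i \<and> i \<noteq> 0"])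
        (auto simp: X lead_x_def lead_y_def lookup_add lookup_single when_def
          dest: jumps_left_unique has_xD)
  next
    case (Y i)
    show ?thesis
      by (rule that[of "\<lambda>p q. q = i \<and> i \<noteq> n + 1"])
        (auto simp: Y lead_x_def lead_y_def lookup_add lookup_single when_def
          dest: jumps_right_unique has_yD)
  qed
  have "Poly_Mapping.lookup (jump_lead n m) v = (\<Sum>(p, q)\<in>jumps n m. if B p q then 1 else 0)"
    unfolding jump_lead_def lookup_sum using B by (intro sum.cong) auto
  also have "\<dots> = card {pq\<in>jumps n m. B (fst pq) (snd pq)}"
    using fin by (simp add: case_prod_beta sum.If_cases Int_def)
  finally have eq: "Poly_Mapping.lookup (jump_lead n m) v = card {pq\<in>jumps n m. B (fst pq) (snd pq)}" .
  have "card {pq\<in>jumps n m. B (fst pq) (snd pq)} \<le> Suc 0"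
    using fin uniq by (subst card_le_Suc0_iff_eq) auto
  moreover have "card {pq\<in>jumps n m. B (fst pq) (snd pq)} = 0" if "Poly_Mapping.lookup m v = 0"
  proof -
    have "v \<notin> Poly_Mapping.keys m" using that by (simp add: in_keys_iff)
    then have "{pq\<in>jumps n m. B (fst pq) (snd pq)} = {}" using keyB by fastforce
    then show ?thesis by (simp only: card.empty)
  qed
  ultimately show ?thesis using eq by (cases "Poly_Mapping.lookup m v = 0") auto
qed

lemma jump_lead_decomp:
  assumes "m \<in> mons n"
  shows "jump_lead n m + (m - jump_lead n m) = m"
  using lookup_jump_lead_le[OF assms] by (intro poly_mapping_eqI) (simp add: lookup_add lookup_minus)

lemma keys_rest: "Poly_Mapping.keys (m - jump_lead n m) \<subseteq> Poly_Mapping.keys m"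
  by (auto simp: in_keys_iff lookup_minus)

lemma rest_mons: "m \<in> mons n \<Longrightarrow> m - jump_lead n m \<in> mons n"
  using keys_rest[of m n] by (auto simp: mons_def)


section \<open>Minors of the bordered matrix\<close>

text \<open>
The rows of the matrix bordered by the columns \<open>(1, 0)\<close> and \<open>(0, 1)\<close>.
\<close>

definition x_row :: "nat \<Rightarrow> nat \<Rightarrow> 'k::comm_ring_1 pol" where
  "x_row n i = (if i = 0 then 1 else if i = n + 1 then 0 else var (X i))"

definition y_row :: "nat \<Rightarrow> nat \<Rightarrow> 'k::comm_ring_1 pol" where
  "y_row n i = (if i = 0 then 0 else if i = n + 1 then 1 else var (Y i))"

definition minor :: "nat \<Rightarrow> nat \<Rightarrow> nat \<Rightarrow> 'k::comm_ring_1 pol" where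
  "minor n p q = x_row n p * y_row n q - x_row n q * y_row n p"

lemma x_row_pols: "i \<le> n + 1 \<Longrightarrow> x_row n i \<in> pols n" and y_row_pols: "i \<le> n + 1 \<Longrightarrow> y_row n i \<in> pols n"
  by (auto simp: x_row_def y_row_def poly_ring_def)

lemma minor_pols: "p \<le> n + 1 \<Longrightarrow> q \<le> n + 1 \<Longrightarrow> minor n p q \<in> pols n"
  unfolding minor_def by (intro pols_diff pols_mult x_row_pols y_row_pols)

lemma x_row_eq: "p \<le> n \<Longrightarrow> x_row n p = Poly_Mapping.single (lead_x p) 1"
  and y_row_eq: "q \<noteq> 0 \<Longrightarrow> y_row n q = Poly_Mapping.single (lead_y n q) 1"
  by (auto simp: x_row_def y_row_def lead_x_def lead_y_def var_def)

definition minors_times :: "nat \<Rightarrow> (nat \<times> nat) set \<Rightarrow> (pvar \<Rightarrow>\<^sub>0 nat) \<Rightarrow> 'k::comm_ring_1 pol" where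
  "minors_times n T r = (\<Prod>(p, q)\<in>T. minor n p q) * Poly_Mapping.single r 1"

lemma minors_times_pols:
  assumes "T \<subseteq> {..n+1} \<times> {..n+1}" "r \<in> mons n"
  shows "minors_times n T r \<in> pols n"
  unfolding minors_times_def using assms
  by (intro pols_mult pols_prod pols_single) (auto intro!: minor_pols)

lemma minors_times_remove:
  assumes "finite T" "(p, q) \<in> T"
  shows "minors_times n T r = minor n p q * minors_times n (T - {(p, q)}) r"
  unfolding minors_times_def using assms by (simp add: prod.remove[of T "(p, q)"] mult.assoc)

lemma minors_times_remove_var:
  assumes "w \<in> Poly_Mapping.keys r"
  shows "minors_times n T r = var w * minors_times n T (r - Poly_Mapping.single w 1)"
proof -
  have "r = Poly_Mapping.single w 1 + (r - Poly_Mapping.single w 1)"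
    using assms by (intro poly_mapping_eqI) (auto simp: lookup_add lookup_minus lookup_single when_def in_keys_iff)
  then have "Poly_Mapping.single r (1::'a) = var w * Poly_Mapping.single (r - Poly_Mapping.single w 1) 1"
    unfolding var_def by (metis mult_single mult_1)
  then show ?thesis by (simp add: minors_times_def ac_simps)
qed

definition meets_col :: "nat \<Rightarrow> (nat \<times> nat) set \<Rightarrow> (pvar \<Rightarrow>\<^sub>0 nat) \<Rightarrow> bool" where
  "meets_col k T r \<longleftrightarrow> (\<exists>(p, q)\<in>T. k = p \<or> k = q) \<or> k \<in> cols r"

lemma minor_in_col:
  assumes L: "ideal L (poly_ring n)" and "var (X k) \<in> L" "var (Y k) \<in> L" "k \<in> {1..n}"
    and "p \<le> n + 1" "q \<le> n + 1" "k = p \<or> k = q"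
  shows "minor n p q \<in> L"
proof -
  have k: "x_row n k \<in> L" "y_row n k \<in> L" using assms by (auto simp: x_row_def y_row_def)
  from assms(7) show ?thesis
  proof
    assume "k = p"
    then show ?thesis unfolding minor_def using k assms(6)
      by (intro ideal_pols(4)[OF L] ideal_pols(6)[OF L, of "y_row n q"] ideal_pols(5)[OF L, of "x_row n q"]
          x_row_pols y_row_pols) simp_all
  next
    assume "k = q"
    then show ?thesis unfolding minor_def using k assms(5)
      by (intro ideal_pols(4)[OF L] ideal_pols(5)[OF L, of "x_row n p"] ideal_pols(6)[OF L, of "y_row n p"]
          x_row_pols y_row_pols) simp_all
  qed
qed

lemma minors_times_in_col:
  assumes L: "ideal L (poly_ring n)" and v: "var (X k) \<in> L" "var (Y k) \<in> L" and k: "k \<in> {1..n}"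
    and T: "T \<subseteq> {..n+1} \<times> {..n+1}" and r: "r \<in> mons n" and c: "meets_col k T r"
  shows "minors_times n T r \<in> L"
proof (cases "\<exists>(p, q)\<in>T. k = p \<or> k = q")
  case True
  then obtain p q where pq: "(p, q) \<in> T" "k = p \<or> k = q" by blast
  have "finite T" using T by (rule finite_subset) simp
  have "minor n p q \<in> L" using minor_in_col[OF L v k] T pq by auto
  moreover have "minors_times n (T - {(p, q)}) r \<in> pols n" using T r by (intro minors_times_pols) auto
  ultimately show ?thesis
    unfolding minors_times_remove[OF \<open>finite T\<close> pq(1)] using ideal_pols(6)[OF L] by blast
next
  case False
  then have "k \<in> cols r" using c by (auto simp: meets_col_def)
  then obtain w where w: "w \<in> Poly_Mapping.keys r" "w = X k \<or> w = Y k" by (auto simp: cols_def)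
  have "Poly_Mapping.keys (r - Poly_Mapping.single w 1) \<subseteq> Poly_Mapping.keys r"
    by (auto simp: in_keys_iff lookup_minus)
  then have "minors_times n T (r - Poly_Mapping.single w 1) \<in> pols n"
    using T r by (intro minors_times_pols) (auto simp: mons_def)
  then show ?thesis
    unfolding minors_times_remove_var[OF w(1)] using ideal_pols(6)[OF L] w(2) v by blast
qed

text \<open>
One factor carries a variable of column \<open>i\<close> and a different factor carries one of column \<open>k\<close>: a
common factor could only be the excluded minor of these two columns. The product of the two
factors lies in the product of the two column ideals.
\<close>

lemma minors_times_in_two_cols:
  assumes L: "ideal L (poly_ring n)"
    and v: "\<And>a b. a \<in> {X i, Y i} \<Longrightarrow> b \<in> {X k, Y k} \<Longrightarrow> var a * var b \<in> L"
    and ik: "i \<in> {1..n}" "k \<in> {1..n}" "i \<noteq> k"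
    and T: "T \<subseteq> {..n+1} \<times> {..n+1}" and r: "r \<in> mons n" and c: "meets_col i T r" "meets_col k T r"
    and no: "(i, k) \<notin> T" "(k, i) \<notin> T"
  shows "minors_times n T r \<in> L"
proof -
  have fin: "finite T" using T by (rule finite_subset) simp
  have vp: "var a \<in> pols n" if "a \<in> {X i, Y i, X k, Y k}" for a
    using that ik by (auto simp: poly_ring_def)
  have peel: "g * h \<in> L"
    if g: "g \<in> pols n" "\<And>M. ideal M (poly_ring n) \<Longrightarrow> var (X i) \<in> M \<Longrightarrow> var (Y i) \<in> M \<Longrightarrow> g \<in> M"
      and h: "h \<in> pols n" "\<And>M. ideal M (poly_ring n) \<Longrightarrow> var (X k) \<in> M \<Longrightarrow> var (Y k) \<in> M \<Longrightarrow> h \<in> M" for g h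
  proof -
    have b: "var b * g \<in> L" if "b \<in> {X k, Y k}" for b
    proof -
      have "g \<in> {a \<in> pols n. a * var b \<in> L}"
        using that v vp by (intro g(2) colon_elem_ideal[OF L]) auto
      then show ?thesis by (simp add: mult.commute)
    qed
    have "h \<in> {a \<in> pols n. a * g \<in> L}"
      using b vp g(1) by (intro h(2) colon_elem_ideal[OF L]) auto
    then show ?thesis by (simp add: mult.commute)
  qed
  show ?thesis
  proof (cases "\<exists>(p, q)\<in>T. i = p \<or> i = q")
    case True
    then obtain p q where pq: "(p, q) \<in> T" "i = p \<or> i = q" by blast
    then have "k \<noteq> p" "k \<noteq> q" using no ik(3) by auto
    then have cov: "meets_col k (T - {(p, q)}) r" using c(2) by (auto simp: meets_col_def)
    have bd: "p \<le> n + 1" "q \<le> n + 1" "T - {(p, q)} \<subseteq> {..n+1} \<times> {..n+1}" using pq(1) T by auto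
    show ?thesis
      unfolding minors_times_remove[OF fin pq(1)]
    proof (rule peel)
      show "minor n p q \<in> pols n" using bd by (intro minor_pols)
      show "minors_times n (T - {(p, q)}) r \<in> pols n" using bd r by (intro minors_times_pols)
      show "minor n p q \<in> M" if "ideal M (poly_ring n)" "var (X i) \<in> M" "var (Y i) \<in> M" for M
        by (rule minor_in_col[OF that ik(1) bd(1,2) pq(2)])
      show "minors_times n (T - {(p, q)}) r \<in> M" if "ideal M (poly_ring n)" "var (X k) \<in> M" "var (Y k) \<in> M" for M
        by (rule minors_times_in_col[OF that ik(2) bd(3) r cov])
    qed
  next
    case False
    then have "i \<in> cols r" using c(1) by (auto simp: meets_col_def)
    then obtain w where w: "w \<in> Poly_Mapping.keys r" "w = X i \<or> w = Y i" by (auto simp: cols_def)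
    let ?r = "r - Poly_Mapping.single w 1"
    have "Poly_Mapping.keys ?r \<subseteq> Poly_Mapping.keys r"
      by (auto simp: in_keys_iff lookup_minus)
    then have r': "?r \<in> mons n" using r by (auto simp: mons_def)
    have "Poly_Mapping.lookup ?r u = Poly_Mapping.lookup r u" if "u \<noteq> w" for u
      using that by (simp add: lookup_minus lookup_single when_def)
    then have cov: "meets_col k T ?r"
      using c(2) w(2) ik(3) by (auto simp: meets_col_def cols_def in_keys_iff)
    show ?thesis
      unfolding minors_times_remove_var[OF w(1)]
    proof (rule peel)
      show "var w \<in> pols n" using w(2) vp by auto
      show "minors_times n T ?r \<in> pols n" using T r' by (rule minors_times_pols)
      show "var w \<in> M" if "var (X i) \<in> M" "var (Y i) \<in> M" for M
        using that w(2) by auto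
      show "minors_times n T ?r \<in> M" if "ideal M (poly_ring n)" "var (X k) \<in> M" "var (Y k) \<in> M" for M
        by (rule minors_times_in_col[OF that ik(2) T r' cov])
    qed
  qed
qed

lemma minor_swap: "minor n q p = - minor n p q"
  by (simp add: minor_def)

text \<open>
The three-term relation \<open>v_i [p, q] = v_p [i, q] - v_q [i, p]\<close> between the minors \<open>[a, b]\<close> of a matrix
with two rows, for either row \<open>v\<close>. The cofactor \<open>g\<close> allows the relation to be applied twice.
\<close>

lemma minor_relation_ideal:
  fixes g :: "'k::comm_ring_1 pol"
  assumes L: "ideal L (poly_ring n)" and "i \<in> {1..n}" "p \<le> n + 1" "q \<le> n + 1"
    and "minor n i q * g \<in> L" "minor n i p * g \<in> L"
  shows "var (X i) * (minor n p q * g) \<in> L" "var (Y i) * (minor n p q * g) \<in> L"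
proof -
  have "x_row n i * (minor n p q * g) = x_row n p * (minor n i q * g) - x_row n q * (minor n i p * g)"
    "y_row n i * (minor n p q * g) = y_row n p * (minor n i q * g) - y_row n q * (minor n i p * g)"
    by (simp_all add: minor_def algebra_simps)
  moreover have "var (X i) = (x_row n i :: 'k pol)" "var (Y i) = (y_row n i :: 'k pol)" using assms(2) by (auto simp: x_row_def y_row_def)
  ultimately show "var (X i) * (minor n p q * g) \<in> L" "var (Y i) * (minor n p q * g) \<in> L"
    by (simp_all only: ideal_pols(4,5)[OF L] assms(3-6) x_row_pols y_row_pols)
qed

lemma minor_eq_minor2: "i \<in> {1..n} \<Longrightarrow> j \<in> {1..n} \<Longrightarrow> minor n i j = minor2 i j"
  by (auto simp: minor_def minor2_def x_row_def y_row_def)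


section \<open>A basis adapted to the minors\<close>

definition basis_elem :: "nat \<Rightarrow> (pvar \<Rightarrow>\<^sub>0 nat) \<Rightarrow> 'k::comm_ring_1 pol" where
  "basis_elem n m = minors_times n (jumps n m) (m - jump_lead n m)"

lemma basis_elem_pols: "m \<in> mons n \<Longrightarrow> basis_elem n m \<in> pols n"
  unfolding basis_elem_def by (intro minors_times_pols jumps_bound rest_mons)

lemma basis_elem_meets_col:
  assumes m: "m \<in> mons n" and k: "k \<in> cols m"
  shows "meets_col k (jumps n m) (m - jump_lead n m)"
proof (rule ccontr)
  assume "\<not> ?thesis"
  then have no: "\<And>p q. (p, q) \<in> jumps n m \<Longrightarrow> k \<noteq> p \<and> k \<noteq> q" and "k \<notin> cols (m - jump_lead n m)"
    by (auto simp: meets_col_def)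
  obtain w where w: "w \<in> Poly_Mapping.keys m" "w = X k \<or> w = Y k" using k by (auto simp: cols_def)
  have "Poly_Mapping.lookup (lead_x p + lead_y n q) w = 0" if "(p, q) \<in> jumps n m" for p q
    using no[OF that] w(2) by (auto simp: lookup_add lead_x_def lead_y_def lookup_single when_def)
  then have "Poly_Mapping.lookup (jump_lead n m) w = 0"
    unfolding jump_lead_def lookup_sum by (intro sum.neutral) auto
  then have "w \<in> Poly_Mapping.keys (m - jump_lead n m)"
    using w(1) by (simp add: in_keys_iff lookup_minus)
  then show False using w(2) \<open>k \<notin> cols (m - jump_lead n m)\<close> by (auto simp: cols_def)
qed

definition y_weight :: "pvar \<Rightarrow> nat" where
  "y_weight v = (case v of X i \<Rightarrow> 0 | Y i \<Rightarrow> i)"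

lemma minor_top:
  assumes "p < q" "q \<le> n + 1"
  shows "has_top y_weight (minor n p q :: 'k::comm_ring_1 pol) (lead_x p + lead_y n q)"
proof (cases "p = 0 \<or> q = n + 1")
  case True
  then have "x_row n q * y_row n p = (0 :: 'k pol)" by (auto simp: x_row_def y_row_def)
  with assms show ?thesis by (simp add: minor_def x_row_eq y_row_eq mult_single has_top_single)
next
  case False
  with assms have "weight y_weight (lead_x q + lead_y n p) < weight y_weight (lead_x p + lead_y n q)"
    by (simp add: weight_add lead_x_def lead_y_def y_weight_def)
  from has_top_diff_single[OF this, of 1] show ?thesis
    using assms False by (simp add: minor_def x_row_eq y_row_eq mult_single)
qed

text \<open>
The weight of \<open>Y q\<close> is \<open>q\<close>, so the product \<open>x_p y_q\<close> is the heavier term of the minor for \<open>p < q\<close>.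
\<close>

lemma basis_elem_top:
  assumes m: "m \<in> mons n"
  shows "has_top y_weight (basis_elem n m) m"
proof -
  have "has_top y_weight (\<Prod>pq\<in>jumps n m. case pq of (p, q) \<Rightarrow> minor n p q)
      (\<Sum>pq\<in>jumps n m. case pq of (p, q) \<Rightarrow> lead_x p + lead_y n q)"
    using finite_jumps[OF m] jumps_D[OF m] by (intro has_top_prod) (auto intro!: minor_top)
  from has_top_mult[OF this has_top_single[of _ "m - jump_lead n m"]] show ?thesis
    by (simp add: basis_elem_def minors_times_def jump_lead_def[symmetric] jump_lead_decomp[OF m])
qed

definition basis_comb :: "nat \<Rightarrow> 'k::comm_ring_1 pol \<Rightarrow> 'k pol" where
  "basis_comb n c = (\<Sum>m\<in>Poly_Mapping.keys c. Poly_Mapping.single 0 (Poly_Mapping.lookup c m) * basis_elem n m)"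

lemma basis_comb_superset:
  assumes "finite A" "Poly_Mapping.keys c \<subseteq> A"
  shows "basis_comb n c = (\<Sum>m\<in>A. Poly_Mapping.single 0 (Poly_Mapping.lookup c m) * basis_elem n m)"
  unfolding basis_comb_def using assms
  by (intro sum.mono_neutral_left) (auto simp: in_keys_iff)

lemma basis_comb_add: "basis_comb n (p + q) = basis_comb n p + basis_comb n q"
proof -
  let ?A = "Poly_Mapping.keys p \<union> Poly_Mapping.keys q"
  have "basis_comb n r = (\<Sum>m\<in>?A. Poly_Mapping.single 0 (Poly_Mapping.lookup r m) * basis_elem n m)"
    if "Poly_Mapping.keys r \<subseteq> ?A" for r
    using that by (intro basis_comb_superset) auto
  from this[of p] this[of q] this[of "p + q"] show ?thesis
    using Poly_Mapping.keys_add[of p q]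
    by (simp add: lookup_add single_add algebra_simps sum.distrib)
qed

lemma basis_comb_single: "basis_comb n (Poly_Mapping.single m a) = Poly_Mapping.single 0 a * basis_elem n m"
  by (cases "a = 0") (simp_all add: basis_comb_def)

lemma basis_comb_of_singles:
  fixes p :: "'k::comm_ring_1 pol"
  assumes "\<And>k. k \<in> Poly_Mapping.keys p \<Longrightarrow>
    \<exists>c\<in>pols n. Poly_Mapping.single k (Poly_Mapping.lookup p k) = basis_comb n c"
  shows "\<exists>c\<in>pols n. p = basis_comb n c"
proof -
  have "\<exists>c\<in>pols n. (\<Sum>k\<in>B. Poly_Mapping.single k (Poly_Mapping.lookup p k)) = basis_comb n c"
    if "finite B" "B \<subseteq> Poly_Mapping.keys p" for B
    using that
  proof (induction B rule: finite_induct)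
    case empty
    show ?case by (rule bexI[of _ 0]) (simp_all add: basis_comb_def)
  next
    case (insert k B)
    then obtain c where c: "c \<in> pols n" "(\<Sum>k\<in>B. Poly_Mapping.single k (Poly_Mapping.lookup p k)) = basis_comb n c"
      by auto
    obtain d where d: "d \<in> pols n" "Poly_Mapping.single k (Poly_Mapping.lookup p k) = basis_comb n d"
      using assms[of k] insert.prems by auto
    show ?case using insert.hyps c d by (intro bexI[of _ "d + c"]) (auto simp: basis_comb_add)
  qed
  from this[OF finite_keys subset_refl] show ?thesis by (simp flip: poly_eq_sum_single)
qed

lemma basis_elem_spans_single:
  fixes a :: "'k::comm_ring_1"
  assumes "m \<in> mons n"
  shows "\<exists>c\<in>pols n. Poly_Mapping.single m a = basis_comb n c"
  using assms
proof (induction "weight y_weight m" arbitrary: m a rule: less_induct)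
  case less
  define s :: "'k pol" where "s = basis_elem n m - Poly_Mapping.single m 1"
  \<comment> \<open>Subtracting the basis element with the same top monomial leaves monomials of smaller weight.\<close>
  define r where "r = Poly_Mapping.single 0 (- a) * s"
  have eq: "Poly_Mapping.single m a = Poly_Mapping.single 0 a * basis_elem n m + r"
    by (simp add: r_def s_def single_uminus algebra_simps mult_single)
  have r: "r \<in> pols n"
    unfolding r_def s_def by (intro pols_mult pols_diff basis_elem_pols pols_single less.prems mons_zero)
  have low: "weight y_weight k < weight y_weight m" if "k \<in> Poly_Mapping.keys r" for k
  proof -
    have "Poly_Mapping.keys r \<subseteq> Poly_Mapping.keys s"
      unfolding r_def by (auto simp: in_keys_iff mult_map_scale_conv_mult[symmetric] Poly_Mapping.map.rep_eq when_def
          split: if_splits)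
    then show ?thesis using that basis_elem_top[OF less.prems] by (auto simp: has_top_def s_def)
  qed
  have "\<exists>c\<in>pols n. r = basis_comb n c"
    by (rule basis_comb_of_singles) (use less.hyps[OF low] r in \<open>auto simp: pols_iff[of r]\<close>)
  then obtain c where "c \<in> pols n" "r = basis_comb n c" by blast
  moreover have "basis_comb n (Poly_Mapping.single m a + c) = Poly_Mapping.single 0 a * basis_elem n m + basis_comb n c"
    by (simp only: basis_comb_add basis_comb_single)
  ultimately have "Poly_Mapping.single m a = basis_comb n (Poly_Mapping.single m a + c)"
    using eq by metis
  then show ?case
    using pols_add[OF pols_single[OF less.prems] \<open>c \<in> pols n\<close>] by blast
qed

lemma basis_elem_spans:
  fixes p :: "'k::comm_ring_1 pol"
  assumes "p \<in> pols n"
  shows "\<exists>c\<in>pols n. p = basis_comb n c"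
proof (rule basis_comb_of_singles)
  fix k assume "k \<in> Poly_Mapping.keys p"
  then have "k \<in> mons n" using assms by (auto simp: pols_iff)
  then show "\<exists>c\<in>pols n. Poly_Mapping.single k (Poly_Mapping.lookup p k) = basis_comb n c"
    by (rule basis_elem_spans_single)
qed


section \<open>Primes of column configurations\<close>

text \<open>
The cuts in \<open>S\<close> divide the columns into consecutive blocks, numbered from \<open>0\<close>. The block \<open>0\<close> contains the
border column \<open>(1, 0)\<close> and the block \<open>card S\<close> contains \<open>(0, 1)\<close>.
\<close>

definition block :: "nat set \<Rightarrow> nat \<Rightarrow> nat" where
  "block S i = card {s\<in>S. s \<le> i}"

text \<open>
Columns parallel to \<open>(1, 0)\<close> have second entry \<open>0\<close>, and columns parallel to \<open>(0, 1)\<close> have first entry \<open>0\<close>.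
\<close>

definition vanishing :: "nat set \<Rightarrow> nat set \<Rightarrow> pvar set" where
  "vanishing D S = {X i | i. i \<notin> D \<or> block S i = card S} \<union> {Y i | i. i \<notin> D \<or> block S i = 0}"

text \<open>
The target variable \<open>2 * i\<close> is a scaling factor \<open>r_i\<close> of column \<open>i\<close> and \<open>2 * c + 1\<close> is the common slope \<open>s_c\<close> of
the columns in block \<open>c\<close>: the column \<open>i\<close> of block \<open>c\<close> is parametrized by \<open>(r_i, r_i s_c)\<close>. In the last block the
first entry vanishes, and there \<open>r_i s_c\<close> simply serves as a free second entry.
\<close>

definition param_exp :: "nat set \<Rightarrow> pvar \<Rightarrow> (nat \<Rightarrow>\<^sub>0 nat)" where
  "param_exp S v = (case v of X i \<Rightarrow> Poly_Mapping.single (2 * i) 1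
     | Y i \<Rightarrow> Poly_Mapping.single (2 * i) 1 + Poly_Mapping.single (2 * block S i + 1) 1)"

definition param :: "nat set \<Rightarrow> nat set \<Rightarrow> 'k::comm_ring_1 pol \<Rightarrow> ((nat \<Rightarrow>\<^sub>0 nat) \<Rightarrow>\<^sub>0 'k)" where
  "param D S = monomial_hom (vanishing D S) (param_exp S)"

definition config_prime :: "nat \<Rightarrow> nat set \<Rightarrow> nat set \<Rightarrow> 'k::comm_ring_1 pol set" where
  "config_prime n D S = {a \<in> pols n. param D S a = 0}"

text \<open>
Without a cut the border columns \<open>(1, 0)\<close> and \<open>(0, 1)\<close> would have to be parallel, so \<open>S\<close> is nonempty.
\<close>

definition config :: "nat \<Rightarrow> nat set \<Rightarrow> nat set \<Rightarrow> bool" where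
  "config n D S \<longleftrightarrow> D \<subseteq> {1..n} \<and> S \<subseteq> {1..n+1} \<and> S \<noteq> {}"

text \<open>
This turns out to say that the basis element of \<open>m\<close> does not vanish on the configurations of \<open>(D, S)\<close>:
no column of \<open>m\<close> is forced to be zero, and no jump of \<open>m\<close> joins two columns that are forced to be parallel.
\<close>

definition compatible :: "nat \<Rightarrow> nat set \<Rightarrow> nat set \<Rightarrow> (pvar \<Rightarrow>\<^sub>0 nat) \<Rightarrow> bool" where
  "compatible n D S m \<longleftrightarrow> cols m \<subseteq> D \<and> (\<forall>(p, q)\<in>jumps n m. S \<inter> {p<..q} \<noteq> {})"

lemma configD:
  assumes "config n D S"
  shows "finite S" "card S > 0" "0 \<notin> D" "n + 1 \<notin> D" "block S 0 = 0" "block S (n + 1) = card S"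
proof -
  show "finite S" using assms by (auto simp: config_def intro: finite_subset)
  then show "card S > 0" using assms by (auto simp: config_def card_gt_0_iff)
  show "0 \<notin> D" "n + 1 \<notin> D" using assms by (auto simp: config_def)
  have "{s\<in>S. s \<le> 0} = {}" using assms by (auto simp: config_def)
  then show "block S 0 = 0" by (simp add: block_def)
  have "{s\<in>S. s \<le> n + 1} = S" using assms by (auto simp: config_def)
  then show "block S (n + 1) = card S" by (simp add: block_def)
qed

lemma block_mono: "finite S \<Longrightarrow> p \<le> q \<Longrightarrow> block S p \<le> block S q"
  unfolding block_def by (intro card_mono) auto

lemma block_less_iff:
  assumes "finite S" "p \<le> q"
  shows "block S p < block S q \<longleftrightarrow> S \<inter> {p<..q} \<noteq> {}"
proof -
  have "{s\<in>S. s \<le> q} = {s\<in>S. s \<le> p} \<union> (S \<inter> {p<..q})" using assms(2) by auto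
  then have "block S q = block S p + card (S \<inter> {p<..q})"
    unfolding block_def using assms(1) by (simp add: card_Un_disjoint Int_def)
  then show ?thesis using assms(1) by (auto simp: card_gt_0_iff)
qed

lemma param_simps:
  "param D S (p + q) = param D S p + param D S q" "param D S (p - q) = param D S p - param D S q"
  "param D S (p * q) = param D S p * param D S q" "param D S 0 = 0" "param D S 1 = 1"
  by (simp_all add: param_def monomial_hom_add monomial_hom_diff monomial_hom_mult)

lemma param_prod: "param D S (\<Prod>a\<in>A. p a) = (\<Prod>a\<in>A. param D S (p a))"
  by (simp add: param_def monomial_hom_prod)

lemma param_sum: "param D S (\<Sum>a\<in>A. p a) = (\<Sum>a\<in>A. param D S (p a))"
  by (simp add: param_def monomial_hom_sum)

lemma param_const: "param D S (Poly_Mapping.single 0 a) = Poly_Mapping.single 0 a"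
  by (simp add: param_def monomial_hom_single)

lemma param_var: "param D S (var v) = (if v \<in> vanishing D S then 0 else Poly_Mapping.single (param_exp S v) 1)"
  by (simp add: param_def var_def monomial_hom_single)

lemma config_prime_ideal: "ideal (config_prime n D S) (poly_ring n)"
  by (rule ideal_polsI) (auto simp: config_prime_def param_simps)

lemma config_prime_is_prime:
  fixes a b :: "'k::idom pol"
  assumes "a \<in> pols n" "b \<in> pols n" "a * b \<in> config_prime n D S"
  shows "a \<in> config_prime n D S \<or> b \<in> config_prime n D S"
  using assms by (auto simp: config_prime_def param_simps)

lemma var_in_config_prime:
  assumes "s \<in> {1..n} - D"
  shows "var (X s) \<in> config_prime n D S" "var (Y s) \<in> config_prime n D S"
  using assms by (auto simp: config_prime_def param_var vanishing_def poly_ring_def)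

lemma param_x_row:
  assumes "config n D S" "p \<le> n + 1"
  shows "param D S (x_row n p) = (if p \<in> D \<union> {0} \<and> block S p < card S
    then Poly_Mapping.single (monomial_image (param_exp S) (lead_x p)) 1 else 0)"
proof -
  have "block S p \<le> card S"
    using block_mono[OF configD(1)[OF assms(1)] assms(2)] configD(6)[OF assms(1)] by simp
  then show ?thesis
    using configD[OF assms(1)] by (auto simp: x_row_def param_simps param_var vanishing_def lead_x_def)
qed

lemma param_y_row:
  assumes "config n D S" "q \<le> n + 1"
  shows "param D S (y_row n q) = (if q \<in> D \<union> {n + 1} \<and> block S q > 0
    then Poly_Mapping.single (monomial_image (param_exp S) (lead_y n q)) 1 else 0)"
  using configD[OF assms(1)] by (auto simp: y_row_def param_simps param_var vanishing_def lead_y_def)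

definition sigma_weight :: "nat \<Rightarrow> nat" where
  "sigma_weight t = (if odd t then t div 2 else 0)"

text \<open>
The leading monomial is the image of \<open>x_p y_q\<close>: slopes of later blocks are heavier, and \<open>q\<close> lies in a
later block than \<open>p\<close>.
\<close>

lemma param_minor_top:
  assumes v: "config n D S" and "p < q" "q \<le> n + 1" "p \<in> D \<union> {0}" "q \<in> D \<union> {n + 1}"
    and S: "S \<inter> {p<..q} \<noteq> {}"
  shows "has_top sigma_weight (param D S (minor n p q :: 'k::comm_ring_1 pol))
    (monomial_image (param_exp S) (lead_x p) + monomial_image (param_exp S) (lead_y n q))"
proof -
  let ?L = "monomial_image (param_exp S) (lead_x p) + monomial_image (param_exp S) (lead_y n q)"
  have c: "block S p < block S q" using block_less_iff[OF configD(1)[OF v], of p q] assms by simp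
  moreover have "block S q \<le> card S"
    using block_mono[OF configD(1)[OF v] assms(3)] configD(6)[OF v] by simp
  ultimately have eq: "param D S (minor n p q) = Poly_Mapping.single ?L 1 - param D S (x_row n q) * param D S (y_row n p :: 'k pol)"
    using assms by (simp add: minor_def param_simps param_x_row param_y_row mult_single)
  show ?thesis
  proof (cases "param D S (x_row n q) * param D S (y_row n p :: 'k pol) = 0")
    case True
    then show ?thesis using eq by (simp add: has_top_single)
  next
    case False
    then have "param D S (x_row n q) \<noteq> (0 :: (nat \<Rightarrow>\<^sub>0 nat) \<Rightarrow>\<^sub>0 'k)" "param D S (y_row n p) \<noteq> (0 :: (nat \<Rightarrow>\<^sub>0 nat) \<Rightarrow>\<^sub>0 'k)" by auto
    then have pq: "p \<noteq> 0" "q \<noteq> n + 1" by (auto simp: x_row_def y_row_def param_simps split: if_splits)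
    have "param D S (x_row n q) * param D S (y_row n p :: 'k pol) =
        Poly_Mapping.single (monomial_image (param_exp S) (lead_x q) + monomial_image (param_exp S) (lead_y n p)) 1"
      using False assms by (simp add: param_x_row param_y_row mult_single split: if_splits)
    moreover have "weight sigma_weight (monomial_image (param_exp S) (lead_x q) + monomial_image (param_exp S) (lead_y n p)) < weight sigma_weight ?L"
      using pq assms c by (simp add: weight_add lead_x_def lead_y_def param_exp_def sigma_weight_def)
    ultimately show ?thesis unfolding eq by (auto intro: has_top_diff_single)
  qed
qed

lemma param_minor_zero:
  assumes v: "config n D S" and "p < q" "q \<le> n + 1"
    and "S \<inter> {p<..q} = {} \<or> p \<notin> D \<union> {0} \<or> q \<notin> D \<union> {n + 1}"
  shows "param D S (minor n p q) = 0"
proof -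
  have le: "block S p \<le> card S" "block S q \<le> card S"
    using block_mono[OF configD(1)[OF v], of _ "n + 1"] configD(6)[OF v] assms by simp_all
  have c: "block S p = block S q" if "S \<inter> {p<..q} = {}"
    using block_less_iff[OF configD(1)[OF v], of p q] block_mono[OF configD(1)[OF v], of p q] assms that by simp
  show ?thesis
  proof (cases "S \<inter> {p<..q} = {} \<and> p \<noteq> 0 \<and> q \<noteq> n + 1")
    \<comment> \<open>Both products in the minor have the same image.\<close>
    case True
    then have "monomial_image (param_exp S) (lead_x p) + monomial_image (param_exp S) (lead_y n q)
       = monomial_image (param_exp S) (lead_x q) + monomial_image (param_exp S) (lead_y n p)"
      using c assms by (simp add: lead_x_def lead_y_def param_exp_def ac_simps)
    with True c assms show ?thesis
      by (auto simp: minor_def param_simps param_x_row param_y_row mult_single)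
  next
    case False
    with assms c le configD[OF v] show ?thesis
      by (auto simp: minor_def param_simps param_x_row param_y_row)
  qed
qed

text \<open>
An \<open>X\<close>-variable of \<open>m\<close> in the last block would give a jump towards the border column \<open>n + 1\<close> that no
cut separates; the argument for \<open>Y\<close>-variables in the block \<open>0\<close> is symmetric.
\<close>

lemma compatible_not_killed:
  assumes v: "config n D S" and m: "m \<in> mons n" and f: "compatible n D S m"
  shows "Poly_Mapping.keys m \<inter> vanishing D S = {}"
proof -
  have c: "block S i < block S j" if ij: "has_x m i" "has_y n m j" "i < j" for i j
  proof -
    obtain p q where pq: "(p, q) \<in> jumps n m" "i \<le> p" "q \<le> j"
      using jumps_between[OF ij] by blast
    then have "S \<inter> {i<..j} \<noteq> {}" using f by (fastforce simp: compatible_def)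
    then show ?thesis using block_less_iff[OF configD(1)[OF v], of i j] ij(3) by simp
  qed
  have D: "cols m \<subseteq> D" using f by (simp add: compatible_def)
  have "X i \<notin> vanishing D S" if "X i \<in> Poly_Mapping.keys m" for i
    using c[of i "n + 1"] that D mons_keys(1)[OF m that] configD(6)[OF v]
    by (auto simp: vanishing_def has_x_def has_y_def cols_def)
  moreover have "Y i \<notin> vanishing D S" if "Y i \<in> Poly_Mapping.keys m" for i
    using c[of 0 i] that D mons_keys(2)[OF m that] configD(5)[OF v]
    by (auto simp: vanishing_def has_x_def has_y_def cols_def)
  ultimately show ?thesis by (metis disjoint_iff pvar.exhaust)
qed

lemma param_basis_elem_top:
  assumes v: "config n D S" and m: "m \<in> mons n" and f: "compatible n D S m"
  shows "has_top sigma_weight (param D S (basis_elem n m)) (monomial_image (param_exp S) m)"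
proof -
  let ?E = "monomial_image (param_exp S)"
  have "has_top sigma_weight (\<Prod>pq\<in>jumps n m. param D S (case pq of (p, q) \<Rightarrow> minor n p q))
      (\<Sum>pq\<in>jumps n m. case pq of (p, q) \<Rightarrow> ?E (lead_x p) + ?E (lead_y n q))"
  proof (intro has_top_prod finite_jumps m)
    fix pq assume pq: "pq \<in> jumps n m"
    obtain p q where [simp]: "pq = (p, q)" by (cases pq)
    show "has_top sigma_weight (param D S (case pq of (p, q) \<Rightarrow> minor n p q))
        (case pq of (p, q) \<Rightarrow> ?E (lead_x p) + ?E (lead_y n q))"
      using jumps_D[OF m, of p q] pq f by (auto simp: compatible_def intro!: param_minor_top[OF v])
  qed
  moreover have "has_top sigma_weight (param D S (Poly_Mapping.single (m - jump_lead n m) 1))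
      (?E (m - jump_lead n m))"
    using compatible_not_killed[OF assms] keys_rest[of m n]
    by (auto simp: param_def monomial_hom_single intro!: has_top_single)
  ultimately have "has_top sigma_weight (param D S (basis_elem n m))
     ((\<Sum>pq\<in>jumps n m. case pq of (p, q) \<Rightarrow> ?E (lead_x p) + ?E (lead_y n q)) + ?E (m - jump_lead n m))"
    unfolding basis_elem_def minors_times_def param_simps param_prod by (rule has_top_mult)
  also have "(\<Sum>pq\<in>jumps n m. case pq of (p, q) \<Rightarrow> ?E (lead_x p) + ?E (lead_y n q)) = ?E (jump_lead n m)"
    by (simp add: jump_lead_def monomial_image_sum monomial_image_add case_prod_beta)
  also have "\<dots> + ?E (m - jump_lead n m) = ?E m"
    by (simp flip: monomial_image_add add: jump_lead_decomp[OF m])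
  finally show ?thesis .
qed

lemma param_basis_elem_zero:
  assumes v: "config n D S" and m: "m \<in> mons n" and f: "\<not> compatible n D S m"
  shows "param D S (basis_elem n m :: 'k::comm_ring_1 pol) = 0"
proof -
  from f consider (col) s where "s \<in> cols m" "s \<notin> D"
    | (jump) p q where "(p, q) \<in> jumps n m" "S \<inter> {p<..q} = {}" by (auto simp: compatible_def)
  then show ?thesis
  proof cases
    case col
    then have s: "s \<in> {1..n} - D" "s \<in> {1..n}" using cols_mons[OF m] by auto
    have "basis_elem n m \<in> (config_prime n D S :: 'k pol set)"
      unfolding basis_elem_def
      by (rule minors_times_in_col[OF config_prime_ideal var_in_config_prime[OF s(1)] s(2) jumps_bound[OF m] rest_mons[OF m]
            basis_elem_meets_col[OF m col(1)]])
    then show ?thesis by (simp add: config_prime_def)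
  next
    case jump
    then have "param D S (minor n p q :: 'k pol) = 0"
      using param_minor_zero[OF v jumps_D(1,2)[OF m jump(1)]] by blast
    then show ?thesis
      unfolding basis_elem_def minors_times_remove[OF finite_jumps[OF m] jump(1)] by (simp add: param_simps)
  qed
qed

lemma monomial_image_lookup:
  assumes m: "m \<in> mons n"
  shows "Poly_Mapping.lookup (monomial_image (param_exp S) m) (2 * i) =
      Poly_Mapping.lookup m (X i) + Poly_Mapping.lookup m (Y i)" (is ?a)
    and "Poly_Mapping.lookup (monomial_image (param_exp S) m) (2 * c + 1) =
      (\<Sum>i | i \<in> {1..n} \<and> block S i = c. Poly_Mapping.lookup m (Y i))" (is ?b)
proof -
  let ?l = "Poly_Mapping.lookup"
  have "monomial_image (param_exp S) m = (\<Sum>v\<in>X ` {1..n} \<union> Y ` {1..n}. of_nat (?l m v) * param_exp S v)"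
    using m by (intro monomial_image_superset) (auto simp: mons_def)
  also have "\<dots> = (\<Sum>i\<in>{1..n}. of_nat (?l m (X i)) * param_exp S (X i)) + (\<Sum>i\<in>{1..n}. of_nat (?l m (Y i)) * param_exp S (Y i))"
    by (subst sum.union_disjoint) (auto simp: sum.reindex inj_on_def)
  finally have eq: "?l (monomial_image (param_exp S) m) t = (\<Sum>i\<in>{1..n}. ?l m (X i) * ?l (param_exp S (X i)) t)
      + (\<Sum>i\<in>{1..n}. ?l m (Y i) * ?l (param_exp S (Y i)) t)" for t
    by (simp only: lookup_add lookup_sum lookup_of_nat_mult)
  have odd: "2 * a \<noteq> Suc (2 * b)" "Suc (2 * b) \<noteq> 2 * a" for a b :: nat by presburger+
  have out: "i \<notin> {1..n} \<Longrightarrow> ?l m (X i) = 0 \<and> ?l m (Y i) = 0"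
    using mons_keys[OF m] by (auto simp: in_keys_iff)
  show ?a unfolding eq
    using out by (cases "i \<in> {1..n}") (auto simp: param_exp_def lookup_add lookup_single when_def odd
        if_distrib[of "\<lambda>x. _ * x"] cong: if_cong)
  show ?b unfolding eq sum.inter_filter[OF finite_atLeastAtMost]
    by (simp add: param_exp_def lookup_add lookup_single when_def odd if_distrib[of "\<lambda>x. _ * x"] cong: if_cong)
qed

text \<open>
The image monomial records the degree of \<open>m\<close> in every column and its total \<open>Y\<close>-degree in every block.
Inside a block a compatible monomial has no \<open>X i\<close> and \<open>Y j\<close> with \<open>i < j\<close>: it consists of \<open>Y\<close>-variables up to
some column and of \<open>X\<close>-variables from that column on. Such a monomial is determined by these degrees.
\<close>

lemma compatible_inj:
  assumes v: "config n D S"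
    and m: "m1 \<in> mons n" "m2 \<in> mons n" "compatible n D S m1" "compatible n D S m2"
    and eq: "monomial_image (param_exp S) m1 = monomial_image (param_exp S) m2"
  shows "m1 = m2"
proof -
  let ?l = "Poly_Mapping.lookup"
  have col: "?l m1 (X i) + ?l m1 (Y i) = ?l m2 (X i) + ?l m2 (Y i)" for i
    using monomial_image_lookup(1)[OF m(1), of S i] monomial_image_lookup(1)[OF m(2), of S i] eq by simp
  have blk: "(\<Sum>i | i \<in> {1..n} \<and> block S i = c. ?l m1 (Y i)) = (\<Sum>i | i \<in> {1..n} \<and> block S i = c. ?l m2 (Y i))" for c
    using monomial_image_lookup(2)[OF m(1), of S c] monomial_image_lookup(2)[OF m(2), of S c] eq by simp
  have no: "?l a (X i) = 0 \<or> ?l a (Y j) = 0"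
    if "a \<in> mons n" "compatible n D S a" "i < j" "block S i = block S j" for a i j
  proof (rule ccontr)
    assume "\<not> ?thesis"
    then have "has_x a i" "has_y n a j" by (auto simp: has_x_def has_y_def in_keys_iff)
    from jumps_between[OF this that(3)] obtain p q where pq: "(p, q) \<in> jumps n a" "i \<le> p" "q \<le> j" by blast
    then have "S \<inter> {i<..j} \<noteq> {}" using that(2) by (fastforce simp: compatible_def)
    then show False using block_less_iff[OF configD(1)[OF v], of i j] that(3,4) by simp
  qed
  have le: "?l a (Y i) \<le> ?l b (Y i)"
    if ab: "a \<in> mons n" "b \<in> mons n" "compatible n D S a" "compatible n D S b"
      and col: "\<And>i. ?l a (X i) + ?l a (Y i) = ?l b (X i) + ?l b (Y i)"
      and blk: "\<And>c. (\<Sum>i | i \<in> {1..n} \<and> block S i = c. ?l a (Y i)) = (\<Sum>i | i \<in> {1..n} \<and> block S i = c. ?l b (Y i))"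
    for a b i
  proof (rule ccontr)
    assume "\<not> ?thesis"
    then have gt: "?l b (Y i) < ?l a (Y i)" by simp
    then have i: "i \<in> {1..n}" using mons_keys(2)[OF ab(1), of i] by (auto simp: in_keys_iff)
    \<comment> \<open>Equal totals over the block force a smaller degree in some other column.\<close>
    have "\<exists>j. j \<in> {1..n} \<and> block S j = block S i \<and> ?l a (Y j) < ?l b (Y j)"
    proof (rule ccontr)
      assume "\<not> ?thesis"
      then have "(\<Sum>j | j \<in> {1..n} \<and> block S j = block S i. ?l b (Y j)) < (\<Sum>j | j \<in> {1..n} \<and> block S j = block S i. ?l a (Y j))"
        using i gt by (intro sum_strict_mono_ex1) (auto simp: not_less)
      then show False using blk[of "block S i"] by simp
    qed
    then obtain j where j: "block S j = block S i" "?l a (Y j) < ?l b (Y j)" by blast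
    have "?l b (X i) > 0" using col[of i] gt by simp
    then have "\<not> i < j" using no[OF ab(2,4), of i j] j by auto
    moreover have "i \<noteq> j" using gt j(2) by auto
    ultimately have "?l a (X j) = 0" using no[OF ab(1,3), of j i] j(1) gt by auto
    then show False using col[of j] j(2) by simp
  qed
  have y: "?l m1 (Y i) = ?l m2 (Y i)" for i
    using le[OF m(1,2,3,4) col blk, of i] le[OF m(2,1,4,3) col[symmetric] blk[symmetric], of i] by simp
  moreover have "?l m1 (X i) = ?l m2 (X i)" for i
    using col[of i] y[of i] by simp
  ultimately have "?l m1 w = ?l m2 w" for w
    by (cases w) simp_all
  then show ?thesis by (rule poly_mapping_eqI)
qed

lemma basis_elem_in_config_prime_iff:
  assumes "config n D S" "m \<in> mons n"
  shows "basis_elem n m \<in> (config_prime n D S :: 'k::comm_ring_1 pol set) \<longleftrightarrow> \<not> compatible n D S m"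
proof
  show "\<not> compatible n D S m" if "basis_elem n m \<in> (config_prime n D S :: 'k pol set)"
    using has_top_lookup(1)[OF param_basis_elem_top[OF assms, where ?'a='k]] that by (auto simp: config_prime_def)
qed (use assms in \<open>auto simp: config_prime_def param_basis_elem_zero basis_elem_pols\<close>)

text \<open>
Applying the parametrization removes the basis elements that lie in the prime, and the images of
the remaining ones are linearly independent since their top monomials are distinct.
\<close>

lemma config_prime_adapted:
  fixes c :: "'k::comm_ring_1 pol"
  assumes v: "config n D S" and c: "c \<in> pols n" and "basis_comb n c \<in> config_prime n D S" and "m \<in> Poly_Mapping.keys c"
  shows "basis_elem n m \<in> (config_prime n D S :: 'k pol set)"
proof (rule ccontr)
  assume "basis_elem n m \<notin> (config_prime n D S :: 'k pol set)"
  define T where "T = {a\<in>Poly_Mapping.keys c. compatible n D S a}"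
  have mons: "a \<in> mons n" if "a \<in> Poly_Mapping.keys c" for a using c that by (auto simp: pols_iff)
  have mT: "m \<in> T" "finite T"
    using \<open>basis_elem n m \<notin> _\<close> assms(4) basis_elem_in_config_prime_iff[OF v mons[OF assms(4)]] by (auto simp: T_def)
  have "0 = param D S (basis_comb n c)" using assms(3) by (simp add: config_prime_def)
  also have "\<dots> = (\<Sum>a\<in>Poly_Mapping.keys c. Poly_Mapping.single 0 (Poly_Mapping.lookup c a) * param D S (basis_elem n a))"
    by (simp add: basis_comb_def param_sum param_simps param_const)
  also have "\<dots> = (\<Sum>a\<in>T. Poly_Mapping.single 0 (Poly_Mapping.lookup c a) * param D S (basis_elem n a))"
    unfolding T_def by (rule sum.mono_neutral_right) (auto simp: param_basis_elem_zero[OF v mons])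
  finally have sum: "(\<Sum>a\<in>T. Poly_Mapping.single 0 (Poly_Mapping.lookup c a) * param D S (basis_elem n a)) = 0" by simp
  have "Poly_Mapping.lookup c m = 0"
  proof (rule tops_independent[OF mT(2) _ _ sum mT(1)])
    show "has_top sigma_weight (param D S (basis_elem n a :: 'k pol)) (monomial_image (param_exp S) a)" if "a \<in> T" for a
      using that mons by (intro param_basis_elem_top[OF v]) (auto simp: T_def)
    show "inj_on (monomial_image (param_exp S)) T"
      using mons by (auto simp: inj_on_def T_def intro: compatible_inj[OF v])
  qed
  then show False using assms(4) by (simp add: in_keys_iff)
qed


section \<open>Knutson ideals are intersections of configuration primes\<close>

text \<open>
The cuts of the configuration that belongs to \<open>m\<close>.
\<close>

definition jump_ends :: "nat \<Rightarrow> (pvar \<Rightarrow>\<^sub>0 nat) \<Rightarrow> nat set" where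
  "jump_ends n m = snd ` jumps n m"

lemma config_jump_ends:
  assumes "m \<in> mons n"
  shows "config n (cols m) (jump_ends n m)"
proof -
  have "jumps n m \<noteq> {}" using jumps_between[of m 0 n "n + 1"] by (auto simp: has_x_def has_y_def)
  moreover have "jump_ends n m \<subseteq> {1..n+1}"
    using jumps_D(1,2)[OF assms] by (fastforce simp: jump_ends_def)
  ultimately show ?thesis using cols_mons[OF assms] by (simp add: config_def jump_ends_def)
qed

lemma compatible_self: "m \<in> mons n \<Longrightarrow> compatible n (cols m) (jump_ends n m) m"
  unfolding compatible_def jump_ends_def using jumps_D(1) by force

text \<open>
A jump \<open>(p, q)\<close> of \<open>m1\<close> contains the right end of a jump of \<open>m2\<close>. That jump of \<open>m2\<close> starts at or after \<open>p\<close>,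
because \<open>p\<close> is a column of \<open>m2\<close> too and so cannot lie strictly inside it; hence its cut in \<open>S\<close> also cuts \<open>(p, q)\<close>.
\<close>

lemma compatible_trans:
  assumes "m1 \<in> mons n" "m2 \<in> mons n" "compatible n (cols m2) (jump_ends n m2) m1" "compatible n D S m2"
  shows "compatible n D S m1"
proof -
  have "S \<inter> {p<..q} \<noteq> {}" if pq: "(p, q) \<in> jumps n m1" for p q
  proof -
    have "jump_ends n m2 \<inter> {p<..q} \<noteq> {}" using assms(3) pq by (auto simp: compatible_def)
    then obtain p' q' where q': "(p', q') \<in> jumps n m2" "p < q'" "q' \<le> q" by (auto simp: jump_ends_def)
    have "p \<in> cols m2 \<union> {0}" using jumps_D(3)[OF assms(1) pq] assms(3) by (auto simp: compatible_def)
    then have "p \<le> p'" using jumps_D(5)[OF assms(2) q'(1), of p] q'(2) by fastforce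
    moreover have "S \<inter> {p'<..q'} \<noteq> {}" using assms(4) q'(1) by (auto simp: compatible_def)
    ultimately show ?thesis using q'(3) by fastforce
  qed
  then show ?thesis using assms(3,4) by (auto simp: compatible_def)
qed

text \<open>
The configuration of \<open>m\<close> itself gives the largest of the configuration primes that avoid the basis
element of \<open>m\<close>. By adaptedness, the inclusion may be checked on basis elements, where it is transitivity
of compatibility.
\<close>

lemma config_prime_least:
  assumes v: "config n D S" and m: "m \<in> mons n" and "basis_elem n m \<notin> (config_prime n D S :: 'k::comm_ring_1 pol set)"
  shows "(config_prime n D S :: 'k pol set) \<subseteq> config_prime n (cols m) (jump_ends n m)"
proof
  fix a :: "'k pol" assume a: "a \<in> config_prime n D S"
  then have "a \<in> pols n" by (simp add: config_prime_def)
  from basis_elem_spans[OF this] obtain c where c: "c \<in> pols n" "a = basis_comb n c" by blast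
  let ?P = "config_prime n (cols m) (jump_ends n m) :: 'k pol set"
  have "basis_elem n k \<in> ?P" if k: "k \<in> Poly_Mapping.keys c" for k
  proof -
    have kn: "k \<in> mons n" using c(1) k by (auto simp: pols_iff)
    have "basis_elem n k \<in> (config_prime n D S :: 'k pol set)" using config_prime_adapted[OF v c(1) _ k] a c(2) by simp
    then have "\<not> compatible n D S k" using basis_elem_in_config_prime_iff[OF v kn] by blast
    moreover have "compatible n D S m" using basis_elem_in_config_prime_iff[OF v m, where ?'k='k] assms(3) by blast
    ultimately have "\<not> compatible n (cols m) (jump_ends n m) k" using compatible_trans[OF kn m] by blast
    then show ?thesis using basis_elem_in_config_prime_iff[OF config_jump_ends[OF m] kn] by blast
  qed
  then show "a \<in> ?P"
    unfolding c(2) basis_comb_def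
    by (intro ideal_sum[OF config_prime_ideal] ideal_pols(5)[OF config_prime_ideal]) auto
qed

text \<open>
Some term in the basis expansion of \<open>a\<close> lies outside \<open>I\<close>, and every configuration prime avoiding this term
avoids \<open>a\<close>. This reduces membership questions to single basis elements.
\<close>

lemma basis_elem_witness:
  fixes I :: "'k::comm_ring_1 pol set"
  assumes I: "ideal I (poly_ring n)" and a: "a \<in> pols n" "a \<notin> I"
  obtains m where "m \<in> mons n" "basis_elem n m \<notin> I"
    "\<And>D S. config n D S \<Longrightarrow> basis_elem n m \<notin> (config_prime n D S :: 'k pol set) \<Longrightarrow> a \<notin> config_prime n D S"
proof -
  obtain c where c: "c \<in> pols n" "a = basis_comb n c" using basis_elem_spans[OF a(1)] by blast
  have "\<exists>m\<in>Poly_Mapping.keys c. basis_elem n m \<notin> I"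
  proof (rule ccontr)
    assume "\<not> ?thesis"
    then have "a \<in> I" unfolding c(2) basis_comb_def
      by (intro ideal_sum[OF I] ideal_pols(5)[OF I]) auto
    with a(2) show False by simp
  qed
  then obtain m where m: "m \<in> Poly_Mapping.keys c" "basis_elem n m \<notin> I" by blast
  show ?thesis
  proof (rule that[OF _ m(2)])
    show "m \<in> mons n" using m(1) c(1) by (auto simp: pols_iff)
    show "a \<notin> config_prime n D S" if "config n D S" "basis_elem n m \<notin> (config_prime n D S :: 'k pol set)" for D S
      using config_prime_adapted[OF that(1) c(1) _ m(1)] that(2) c(2) by blast
  qed
qed

lemma knutson_poly_eq:
  assumes "n \<ge> 1"
  shows "knutson_poly n = (\<Prod>s=1..n+1. minor n (s - 1) s)"
proof -
  have split: "{1..n+1} = insert 1 (insert (n + 1) (Suc ` {1..<n}))"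
    using assms by auto
  have "(\<Prod>s=1..n+1. minor n (s - 1) s :: 'a pol) = minor n 0 1 * (minor n n (n + 1) * (\<Prod>s\<in>Suc ` {1..<n}. minor n (s - 1) s))"
    unfolding split using assms by (subst prod.insert; auto)+
  also have "(\<Prod>s\<in>Suc ` {1..<n}. minor n (s - 1) s :: 'a pol) = (\<Prod>i=1..<n. minor2 i (i + 1))"
    by (subst prod.reindex) (auto simp: minor_def minor2_def x_row_def y_row_def intro!: prod.cong)
  finally have "(\<Prod>s=1..n+1. minor n (s - 1) s :: 'a pol)
      = minor n 0 1 * (minor n n (n + 1) * (\<Prod>i=1..<n. minor2 i (i + 1)))" .
  moreover have "minor n 0 1 = (var (Y 1) :: 'a pol)" "minor n n (n + 1) = (var (X n) :: 'a pol)"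
    using assms by (simp_all add: minor_def x_row_def y_row_def)
  ultimately show ?thesis by (simp only: knutson_poly_def ac_simps)
qed

lemma basis_elem_full_jumps:
  assumes n: "n \<ge> 1" and m: "m \<in> mons n" and "{1..n+1} \<subseteq> jump_ends n m"
  shows "basis_elem n m \<in> PIdl\<^bsub>poly_ring n\<^esub> (knutson_poly n)"
proof -
  have ex: "\<exists>p. (p, s) \<in> jumps n m" if "s \<in> {1..n+1}" for s
    using assms(3) that by (force simp: jump_ends_def)
  have pred: "p = q - 1" if pq: "(p, q) \<in> jumps n m" for p q
  proof (rule ccontr)
    assume "p \<noteq> q - 1"
    then have lt: "p < q - 1" "q - 1 < q" "q - 1 \<in> {1..n+1}" using jumps_D(1,2)[OF m pq] by auto
    then obtain r where "(r, q - 1) \<in> jumps n m" using ex by blast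
    then have "has_y n m (q - 1)" by (auto simp: jumps_def)
    then show False using pq lt(1,2) by (auto simp: jumps_def)
  qed
  have "jumps n m = (\<lambda>s. (s - 1, s)) ` {1..n+1}"
  proof (rule equalityI; rule subsetI)
    fix x assume x: "x \<in> jumps n m"
    then show "x \<in> (\<lambda>s. (s - 1, s)) ` {1..n+1}"
      using pred[of "fst x" "snd x"] jumps_D(1,2)[OF m, of "fst x" "snd x"] by (cases x) auto
  next
    fix x assume "x \<in> (\<lambda>s. (s - 1, s)) ` {1..n+1}"
    then obtain s where s: "s \<in> {1..n+1}" "x = (s - 1, s)" by blast
    then show "x \<in> jumps n m" using ex[OF s(1)] pred by blast
  qed
  then have "basis_elem n m = (\<Prod>s=1..n+1. minor n (s - 1) s) * Poly_Mapping.single (m - jump_lead n m) 1"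
    unfolding basis_elem_def minors_times_def by (subst \<open>jumps n m = _\<close>, subst prod.reindex) (auto simp: inj_on_def)
  moreover have "Poly_Mapping.single (m - jump_lead n m) 1 \<in> pols n"
    using m keys_rest[of m n] by (intro pols_single) (auto simp: mons_def)
  ultimately show ?thesis
    unfolding cgenideal_def knutson_poly_eq[OF n] by (auto simp: mult.commute)
qed

text \<open>
By induction over the construction, a Knutson ideal is the intersection of the configuration
primes above it.
\<close>

theorem knutson_separated:
  fixes I :: "'k::idom pol set"
  assumes n: "n \<ge> 1" and I: "I \<in> knutson_ideals (poly_ring n) (knutson_poly n)"
    and a: "a \<in> pols n" "a \<notin> I"
  shows "\<exists>D S. config n D S \<and> I \<subseteq> config_prime n D S \<and> a \<notin> config_prime n D S"
  using I a
proof (induction arbitrary: a rule: knutson_ideals.induct)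
  case principal
  let ?I = "PIdl\<^bsub>poly_ring n\<^esub> (knutson_poly n) :: 'k pol set"
  note f = knutson_poly_in_carrier[OF n, where ?'k='k]
  have "ideal ?I (poly_ring n)" by (rule cring.cgenideal_ideal[OF cring_poly_ring f])
  from basis_elem_witness[OF this principal] obtain m where m: "m \<in> mons n" "basis_elem n m \<notin> ?I"
    "\<And>D S. config n D S \<Longrightarrow> basis_elem n m \<notin> (config_prime n D S :: 'k pol set) \<Longrightarrow> a \<notin> config_prime n D S" by blast
  let ?P = "config_prime n (cols m) (jump_ends n m) :: 'k pol set"
  note v = config_jump_ends[OF m(1)]
  have "\<not> {1..n+1} \<subseteq> jump_ends n m" using basis_elem_full_jumps[OF n m(1), where ?'a='k] m(2) by blast
  then obtain s where s: "s \<in> {1..n+1}" "s \<notin> jump_ends n m" by blast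
  moreover have "{s - 1<..s} = {s}" using s(1) by auto
  ultimately have "jump_ends n m \<inter> {s - 1<..s} = {}" by simp
  then have "param (cols m) (jump_ends n m) (minor n (s - 1) s :: 'k pol) = 0"
    using param_minor_zero[OF v, of "s - 1" s] s(1) by auto
  then have "param (cols m) (jump_ends n m) (knutson_poly n :: 'k pol) = 0"
    unfolding knutson_poly_eq[OF n] param_prod using s(1) by (intro prod_zero) auto
  then have "?I \<subseteq> ?P" using f unfolding cgenideal_def by (auto simp: config_prime_def param_simps)
  moreover have "basis_elem n m \<notin> ?P" using basis_elem_in_config_prime_iff[OF v m(1)] compatible_self[OF m(1)] by blast
  ultimately show ?case using m(3) v by blast
next
  case (colon I J)
  then have "\<exists>b\<in>J. a * b \<notin> I" by (auto simp: colon_ideal_def)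
  then obtain b where b: "b \<in> J" "a * b \<notin> I" by blast
  have bn: "b \<in> pols n" using ideal_pols(1)[OF colon(2)] b(1) by blast
  then have "a * b \<in> pols n" using colon by blast
  from colon.IH[OF this b(2)] obtain D S where DS: "config n D S" "I \<subseteq> config_prime n D S" "a * b \<notin> config_prime n D S" by blast
  then have "a \<notin> config_prime n D S" "b \<notin> config_prime n D S"
    using ideal_pols(5,6)[OF config_prime_ideal] bn colon by blast+
  moreover have "colon_ideal (poly_ring n) I J \<subseteq> config_prime n D S"
  proof
    fix c assume c: "c \<in> colon_ideal (poly_ring n) I J"
    then have "c * b \<in> config_prime n D S" "c \<in> pols n" using b(1) DS(2) by (auto simp: colon_ideal_def)
    then show "c \<in> config_prime n D S" using config_prime_is_prime[OF _ bn] \<open>b \<notin> config_prime n D S\<close> by blast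
  qed
  ultimately show ?case using DS(1) by blast
next
  case (sum I J)
  have IJ: "ideal I (poly_ring n)" "ideal J (poly_ring n)"
    using knutson_ideals_ideal(1)[OF cring_poly_ring knutson_poly_in_carrier[OF n]] sum.hyps by blast+
  have "ideal (I <+>\<^bsub>poly_ring n\<^esub> J) (poly_ring n)"
    using ring.add_ideals[OF cring.axioms(1)[OF cring_poly_ring] IJ] .
  from basis_elem_witness[OF this sum.prems] obtain m where m: "m \<in> mons n" "basis_elem n m \<notin> I <+>\<^bsub>poly_ring n\<^esub> J"
    "\<And>D S. config n D S \<Longrightarrow> basis_elem n m \<notin> (config_prime n D S :: 'k pol set) \<Longrightarrow> a \<notin> config_prime n D S" by blast
  let ?P = "config_prime n (cols m) (jump_ends n m) :: 'k pol set"
  note v = config_jump_ends[OF m(1)]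
  have nI: "basis_elem n m \<notin> I" "basis_elem n m \<notin> J"
    using m(2) ideal_pols(2)[OF IJ(1)] ideal_pols(2)[OF IJ(2)] by (force simp: set_add_def')+
  have "I \<subseteq> ?P" "J \<subseteq> ?P"
    using sum.IH(1)[OF basis_elem_pols[OF m(1)] nI(1)] sum.IH(2)[OF basis_elem_pols[OF m(1)] nI(2)] config_prime_least[OF _ m(1)]
    by blast+
  then have "I <+>\<^bsub>poly_ring n\<^esub> J \<subseteq> ?P"
    by (auto simp: set_add_def' intro!: ideal_pols(3)[OF config_prime_ideal])
  moreover have "basis_elem n m \<notin> ?P" using basis_elem_in_config_prime_iff[OF v m(1)] compatible_self[OF m(1)] by blast
  ultimately show ?case using m(3) v by blast
next
  case (inter I J)
  from inter.prems(2) consider "a \<notin> I" | "a \<notin> J" by blast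
  then show ?case
  proof cases
    case 1
    from inter.IH(1)[OF inter.prems(1) this] show ?thesis by (meson Int_lower1 subset_trans)
  next
    case 2
    from inter.IH(2)[OF inter.prems(1) this] show ?thesis by (meson Int_lower2 subset_trans)
  qed
qed


section \<open>Knutson binomial edge ideals come from weakly closed labelings\<close>

lemma edge_ideal_least:
  fixes I :: "'k::comm_ring_1 pol set"
  assumes "ideal I (poly_ring n)" "\<And>i j. {i, j} \<in> E \<Longrightarrow> minor2 i j \<in> I"
  shows "binomial_edge_ideal n E \<subseteq> I"
  unfolding binomial_edge_ideal_def
  by (rule ring.genideal_minimal[OF cring.axioms(1)[OF cring_poly_ring] assms(1)]) (use assms(2) in auto)

lemma edge_ideal:
  assumes "\<Union>E \<subseteq> {1..n}"
  shows "ideal (binomial_edge_ideal n E :: 'k::comm_ring_1 pol set) (poly_ring n)"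
    and "{i, j} \<in> E \<Longrightarrow> minor2 i j \<in> (binomial_edge_ideal n E :: 'k pol set)"
proof -
  have sub: "{minor2 i j | i j. {i, j} \<in> E} \<subseteq> (pols n :: 'k pol set)"
    using assms by (auto intro!: minor2_in_carrier)
  show "ideal (binomial_edge_ideal n E :: 'k pol set) (poly_ring n)"
    unfolding binomial_edge_ideal_def
    by (rule ring.genideal_ideal[OF cring.axioms(1)[OF cring_poly_ring] sub])
  show "minor2 i j \<in> (binomial_edge_ideal n E :: 'k pol set)" if "{i, j} \<in> E"
    using ring.genideal_self[OF cring.axioms(1)[OF cring_poly_ring] sub] that
    unfolding binomial_edge_ideal_def by auto
qed

text \<open>
Evaluate at the matrix whose columns \<open>i\<close> and \<open>k\<close> are \<open>(1, 0)\<close>, whose column \<open>j\<close> is \<open>(0, 1)\<close> and whose other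
columns are zero. The only minors that do not vanish there are those of the columns \<open>i, j\<close> and \<open>j, k\<close>.
\<close>

lemma minor_outside_edge_ideal:
  assumes E: "\<Union>E \<subseteq> {1..n}" and "i \<in> {1..n}" "j \<in> {1..n}" "k \<in> {1..n}" "i < j" "j < k"
    and "{i, j} \<notin> E" "{j, k} \<notin> E"
  shows "var (X k) * minor2 i j \<notin> (binomial_edge_ideal n E :: 'k::comm_ring_1 pol set)"
proof -
  define h :: "'k pol \<Rightarrow> (nat \<Rightarrow>\<^sub>0 nat) \<Rightarrow>\<^sub>0 'k" where "h = monomial_hom (- {X i, X k, Y j}) (\<lambda>_. 0)"
  have var: "h (var v) = (if v \<in> {X i, X k, Y j} then 1 else 0)" for v
    by (auto simp: h_def var_def monomial_hom_single)
  have simps: "h (p + q) = h p + h q" "h (p - q) = h p - h q" "h (p * q) = h p * h q" "h 0 = 0" for p q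
    by (simp_all add: h_def monomial_hom_add monomial_hom_diff monomial_hom_mult)
  have "ideal {p \<in> pols n. h p = 0} (poly_ring n)"
    by (rule ideal_polsI) (auto simp: simps)
  moreover have "minor2 a b \<in> {p \<in> pols n. h p = 0}" if "{a, b} \<in> E" for a b
  proof -
    have "a \<in> {1..n}" "b \<in> {1..n}" using E that by blast+
    then have "minor2 a b \<in> (pols n :: 'k pol set)" by (rule minor2_in_carrier)
    moreover have "\<not> (a \<in> {i, k} \<and> b = j)" "\<not> (b \<in> {i, k} \<and> a = j)"
      using that assms(7,8) by (auto simp: insert_commute)
    then have "h (minor2 a b) = 0" by (auto simp: minor2_def simps var)
    ultimately show ?thesis by simp
  qed
  ultimately have "binomial_edge_ideal n E \<subseteq> {p \<in> pols n. h p = 0}" by (rule edge_ideal_least)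
  moreover have "h (var (X k) * minor2 i j) = 1"
    using assms by (simp add: minor2_def simps var)
  ultimately show ?thesis by auto
qed

theorem knutson_imp_weakly_closed:
  assumes E: "\<Union>E \<subseteq> {1..n}"
    and K: "(binomial_edge_ideal n E :: 'k::idom pol set) \<in> knutson_ideals (poly_ring n) (knutson_poly n)"
    and ijk: "1 \<le> i" "i < j" "j < k" "k \<le> n" and ik: "{i, k} \<in> E"
  shows "{i, j} \<in> E \<or> {j, k} \<in> E"
proof (rule ccontr)
  assume "\<not> ?thesis"
  then have ne: "{i, j} \<notin> E" "{j, k} \<notin> E" by auto
  let ?J = "binomial_edge_ideal n E :: 'k pol set"
  have mem: "i \<in> {1..n}" "j \<in> {1..n}" "k \<in> {1..n}" using ijk by auto
  have kin: "var (X k) \<in> (pols n :: 'k pol set)" using mem by (auto simp: poly_ring_def)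
  have in_pols: "var (X k) * minor2 i j \<in> (pols n :: 'k pol set)"
    using mem kin by (intro pols_mult minor2_in_carrier)
  have "var (X k) * minor2 i j \<notin> ?J"
    by (rule minor_outside_edge_ideal[OF E mem ijk(2,3) ne])
  then obtain D S where DS: "config n D S" "?J \<subseteq> config_prime n D S"
    "var (X k) * minor2 i j \<notin> (config_prime n D S :: 'k pol set)"
    using knutson_separated[OF _ K in_pols] ijk by auto
  have nz: "param D S (var (X k) :: 'k pol) \<noteq> 0" "param D S (minor n i j :: 'k pol) \<noteq> 0"
    using DS(3) in_pols mem by (auto simp: config_prime_def param_simps minor_eq_minor2)
  have "k \<in> D" using nz(1) by (auto simp: param_var vanishing_def split: if_splits)
  moreover have "S \<inter> {i<..j} \<noteq> {}" "i \<in> D \<union> {0}"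
    using param_minor_zero[OF DS(1) ijk(2), where ?'a='k] nz(2) mem by auto
  moreover have "S \<inter> {i<..k} \<noteq> {}" using \<open>S \<inter> {i<..j} \<noteq> {}\<close> ijk by fastforce
  ultimately have "has_top sigma_weight (param D S (minor n i k :: 'k pol))
      (monomial_image (param_exp S) (lead_x i) + monomial_image (param_exp S) (lead_y n k))"
    using mem ijk by (intro param_minor_top[OF DS(1)]) auto
  then have "param D S (minor n i k :: 'k pol) \<noteq> 0" using has_top_lookup(1) by fastforce
  moreover have "minor n i k \<in> ?J" using edge_ideal(2)[OF E ik] mem by (simp add: minor_eq_minor2)
  ultimately show False using DS(2) by (auto simp: config_prime_def)
qed


section \<open>Nonzero configuration primes are Knutson ideals\<close>

text \<open>
The prime is generated by the variables of the columns outside \<open>D\<close> and the minors of columns that no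
cut separates: each basis element in the prime is incompatible with the configuration and so has
one of these as a factor or lies in the ideal of a column outside \<open>D\<close>.
\<close>

lemma config_prime_generated:
  fixes L :: "'k::comm_ring_1 pol set"
  assumes L: "ideal L (poly_ring n)" and v: "config n D S"
    and X: "\<And>s. s \<in> {1..n} - D \<Longrightarrow> var (X s) \<in> L \<and> var (Y s) \<in> L"
    and M: "\<And>p q. p < q \<Longrightarrow> q \<le> n + 1 \<Longrightarrow> S \<inter> {p<..q} = {} \<Longrightarrow> minor n p q \<in> L"
  shows "config_prime n D S \<subseteq> L"
proof
  fix a :: "'k pol" assume a: "a \<in> config_prime n D S"
  then have "a \<in> pols n" by (simp add: config_prime_def)
  from basis_elem_spans[OF this] obtain c where c: "c \<in> pols n" "a = basis_comb n c" by blast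
  have "basis_elem n m \<in> L" if m: "m \<in> Poly_Mapping.keys c" for m
  proof -
    have mn: "m \<in> mons n" using c(1) m by (auto simp: pols_iff)
    note bd = jumps_bound[OF mn] rest_mons[OF mn]
    have "\<not> compatible n D S m"
      using config_prime_adapted[OF v c(1) _ m] a c(2) basis_elem_in_config_prime_iff[OF v mn, where ?'k='k] by blast
    then consider (col) s where "s \<in> cols m" "s \<notin> D"
      | (jump) p q where "(p, q) \<in> jumps n m" "S \<inter> {p<..q} = {}" by (auto simp: compatible_def)
    then show ?thesis
    proof cases
      case col
      then have "s \<in> {1..n} - D" "s \<in> {1..n}" using cols_mons[OF mn] by auto
      then show ?thesis
        unfolding basis_elem_def using X basis_elem_meets_col[OF mn col(1)] by (intro minors_times_in_col[OF L _ _ _ bd]) auto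
    next
      case jump
      then have "minor n p q \<in> L" using jumps_D(1,2)[OF mn jump(1)] by (intro M) auto
      moreover have "minors_times n (jumps n m - {(p, q)}) (m - jump_lead n m) \<in> pols n"
        using bd by (intro minors_times_pols) auto
      ultimately show ?thesis
        unfolding basis_elem_def minors_times_remove[OF finite_jumps[OF mn] jump(1)]
        using ideal_pols(6)[OF L] by blast
    qed
  qed
  then show "a \<in> L"
    unfolding c(2) basis_comb_def by (intro ideal_sum[OF L] ideal_pols(5)[OF L]) auto
qed

lemma minor_in_config_prime:
  assumes "config n D S" "p < q" "q \<le> n + 1" "S \<inter> {p<..q} = {}"
  shows "minor n p q \<in> config_prime n D S"
  using assms by (auto simp: config_prime_def param_minor_zero intro!: minor_pols)

lemma config_prime_mono:
  assumes "config n D S" "config n D' S'" "D' \<subseteq> D" "S' \<subseteq> S"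
  shows "config_prime n D S \<subseteq> config_prime n D' S'"
  using assms by (intro config_prime_generated[OF config_prime_ideal] minor_in_config_prime conjI var_in_config_prime) auto

lemma minor_notin_config_prime:
  assumes "config n D S" "p < q" "q \<le> n + 1" "S \<inter> {p<..q} \<noteq> {}" "p \<in> D \<union> {0}" "q \<in> D \<union> {n + 1}"
  shows "param D S (minor n p q :: 'k::comm_ring_1 pol) \<noteq> 0" "minor n p q \<notin> (config_prime n D S :: 'k pol set)"
  using has_top_lookup(1)[OF param_minor_top[OF assms(1-3,5,6,4), where ?'k='k]] by (auto simp: config_prime_def)

lemma full_meets: "p < q \<Longrightarrow> q \<le> n + 1 \<Longrightarrow> {1..n+1} \<inter> {p<..q} \<noteq> {}" for p q n :: nat
  by (auto simp: disjoint_iff intro!: exI[of _ q])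

lemma config_gap:
  assumes "p < q" "q \<le> n + 1" "p \<noteq> 0 \<or> q \<noteq> n + 1"
  shows "config n {1..n} ({1..n+1} - {p<..q})" (is "config _ _ ?S")
proof -
  have "1 \<in> {1..n+1} - {p<..q} \<or> n + 1 \<in> {1..n+1} - {p<..q}" using assms by auto
  then have "?S \<noteq> {}" by blast
  then show ?thesis unfolding config_def by blast
qed

text \<open>
With all columns and all cuts there is no constraint on the matrix.
\<close>

lemma config_prime_full_zero: "config_prime n {1..n} {1..n+1} = {0}"
proof
  have "ideal {0} (poly_ring n)" by (rule ideal_polsI) auto
  then show "config_prime n {1..n} {1..n+1} \<subseteq> {0}"
    using full_meets by (intro config_prime_generated) (auto simp: config_def)
qed (auto simp: config_prime_def param_simps)

lemma knutson_pols_ideal: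
  assumes "n \<ge> 1" "I \<in> knutson_ideals (poly_ring n) (knutson_poly n :: 'k::comm_ring_1 pol)"
  shows "ideal I (poly_ring n)"
  using knutson_ideals_ideal(1)[OF cring_poly_ring knutson_poly_in_carrier[OF assms(1)] assms(2)] .

text \<open>
The ideal \<open>L\<close> is the sum of the family, described by its universal property.
\<close>

lemma knutson_family_sum:
  assumes n: "n \<ge> 1" and "finite T" "T \<noteq> {}"
    and "T \<subseteq> knutson_ideals (poly_ring n) (knutson_poly n :: 'k::comm_ring_1 pol)"
  shows "\<exists>L\<in>knutson_ideals (poly_ring n) (knutson_poly n :: 'k pol). (\<forall>I\<in>T. I \<subseteq> L) \<and>
    (\<forall>M. ideal M (poly_ring n) \<longrightarrow> (\<forall>I\<in>T. I \<subseteq> M) \<longrightarrow> L \<subseteq> M)"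
  using assms(2-4)
proof (induction T rule: finite_ne_induct)
  case (singleton I)
  then show ?case by (intro bexI[of _ I]) auto
next
  case (insert I T)
  then obtain L where L: "L \<in> knutson_ideals (poly_ring n) (knutson_poly n :: 'k pol)" "\<And>I. I \<in> T \<Longrightarrow> I \<subseteq> L"
    "\<And>M. ideal M (poly_ring n) \<Longrightarrow> (\<forall>I\<in>T. I \<subseteq> M) \<Longrightarrow> L \<subseteq> M" by auto
  have I: "I \<in> knutson_ideals (poly_ring n) (knutson_poly n :: 'k pol)" using insert.prems by simp
  let ?L = "I <+>\<^bsub>poly_ring n\<^esub> L"
  have "0 \<in> I" "0 \<in> L" using ideal_pols(2) knutson_pols_ideal[OF n] I L(1) by blast+
  then have sub: "I \<subseteq> ?L" "L \<subseteq> ?L" by (force simp: set_add_def')+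
  show ?case
  proof (intro bexI[of _ ?L] conjI allI impI ballI)
    show "?L \<in> knutson_ideals (poly_ring n) (knutson_poly n :: 'k pol)"
      using I L(1) by (rule knutson_ideals.sum)
    show "K \<subseteq> ?L" if "K \<in> insert I T" for K using that sub L(2) by blast
    show "?L \<subseteq> M" if M: "ideal M (poly_ring n)" "\<forall>K\<in>insert I T. K \<subseteq> M" for M
    proof -
      have "I \<subseteq> M" "L \<subseteq> M" using L(3)[OF M(1)] M(2) by auto
      then show ?thesis using ideal_pols(3)[OF M(1)] by (auto simp: set_add_def')
    qed
  qed
qed

lemma knutson_family_inter:
  assumes "finite T" "T \<noteq> {}" "T \<subseteq> knutson_ideals R f"
  shows "\<Inter>T \<in> knutson_ideals R f"
  using assms by (induction T rule: finite_ne_induct) (auto intro: knutson_ideals.inter)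

lemma config_single_gap:
  assumes "n \<ge> 1"
  shows "config n {1..n} ({1..n+1} - {s})" (is "config _ _ ?S")
proof -
  have "1 \<in> {1..n+1} - {s} \<or> n + 1 \<in> {1..n+1} - {s}" using assms by auto
  then have "?S \<noteq> {}" by blast
  then show ?thesis unfolding config_def by blast
qed

lemma full_gap_singleton:
  fixes p q n :: nat
  assumes "p < q" "q \<le> n + 1" "({1..n+1} - {s}) \<inter> {p<..q} = {}"
  shows "q = s \<and> p = s - 1"
proof -
  have "q \<in> {1..n+1} \<inter> {p<..q}" "Suc p \<in> {1..n+1} \<inter> {p<..q}" using assms(1,2) by auto
  then have "q = s" "Suc p = s" using assms(3) by blast+
  then show ?thesis by auto
qed

lemma minor_in_gap:
  assumes "n \<ge> 1" "s \<in> {1..n+1}"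
  shows "minor n (s - 1) s \<in> config_prime n {1..n} ({1..n+1} - {s})"
proof -
  have "{s - 1<..s} = {s}" using assms(2) by auto
  then show ?thesis using assms(2) by (intro minor_in_config_prime[OF config_single_gap[OF assms(1)]]) auto
qed

text \<open>
The ideal generated by one factor of \<open>f\<close> is the colon ideal of \<open>(f)\<close> by the product of the other factors.
\<close>

lemma knutson_adjacent:
  assumes n: "n \<ge> 1" and s: "s \<in> {1..n+1}"
  shows "(config_prime n {1..n} ({1..n+1} - {s}) :: 'k::idom pol set) \<in> knutson_ideals (poly_ring n) (knutson_poly n)"
proof -
  let ?f = "knutson_poly n :: 'k pol"
  let ?P = "config_prime n {1..n} ({1..n+1} - {s}) :: 'k pol set"
  define g :: "'k pol" where "g = (\<Prod>t\<in>{1..n+1} - {s}. minor n (t - 1) t)"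
  let ?F = "minor n (s - 1) s :: 'k pol"
  have f: "?f = ?F * g" unfolding knutson_poly_eq[OF n] g_def using s by (intro prod.remove) auto
  have g: "g \<in> pols n" unfolding g_def by (intro pols_prod minor_pols) auto
  have F: "?F \<in> pols n" using s by (intro minor_pols) auto
  note v = config_single_gap[OF n, of s]
  have vfull: "config n {1..n} {1..n+1}" by (auto simp: config_def)
  have fp: "?f \<in> pols n" using f F g by auto
  have PI: "PIdl\<^bsub>poly_ring n\<^esub> h = {r * h | r. r \<in> pols n}" for h :: "'k pol"
    by (simp add: cgenideal_def)
  have Jg: "ideal (PIdl\<^bsub>poly_ring n\<^esub> g) (poly_ring n)"
    by (rule cring.cgenideal_ideal[OF cring_poly_ring g])
  let ?C = "colon_ideal (poly_ring n) (PIdl\<^bsub>poly_ring n\<^esub> ?f) (PIdl\<^bsub>poly_ring n\<^esub> g)"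
  have C: "?C \<in> knutson_ideals (poly_ring n) ?f"
    by (rule knutson_ideals.colon[OF knutson_ideals.principal Jg])
  have FP: "?F \<in> ?P" by (rule minor_in_gap[OF n s])
  have "?C \<subseteq> ?P"
  proof
    fix a assume a: "a \<in> ?C"
    then have an: "a \<in> pols n" by (simp add: colon_ideal_def)
    have "g \<in> PIdl\<^bsub>poly_ring n\<^esub> g" unfolding PI by (auto intro!: exI[of _ 1])
    then have "a * g \<in> PIdl\<^bsub>poly_ring n\<^esub> ?f" using a by (simp add: colon_ideal_def)
    then obtain r where r: "r \<in> pols n" "a * g = r * ?f" unfolding PI by auto
    then have "(a - r * ?F) * g = 0" using f by (simp add: algebra_simps)
    then have prod: "(a - r * ?F) * g \<in> config_prime n {1..n} {1..n+1}" unfolding config_prime_full_zero by simp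
    have "g \<notin> config_prime n {1..n} {1..n+1}"
    proof -
      have "param {1..n} {1..n+1} (minor n (t - 1) t :: 'k pol) \<noteq> 0" if "t \<in> {1..n+1}" for t
        using that by (intro minor_notin_config_prime(1)[OF vfull]) auto
      then have "param {1..n} {1..n+1} g \<noteq> 0" unfolding g_def param_prod by (auto simp: prod_zero_iff)
      then show ?thesis by (simp add: config_prime_def)
    qed
    moreover have "a - r * ?F \<in> pols n" by (intro pols_diff pols_mult an r(1) F)
    ultimately have "a - r * ?F \<in> config_prime n {1..n} {1..n+1}"
      using config_prime_is_prime[OF _ g prod] by blast
    then have "a = r * ?F" unfolding config_prime_full_zero by simp
    then show "a \<in> ?P" using ideal_pols(5)[OF config_prime_ideal r(1) FP] by simp
  qed
  moreover have "?P \<subseteq> ?C"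
  proof (rule config_prime_generated[OF knutson_pols_ideal[OF n C] v])
    fix p q assume pq: "p < q" "q \<le> n + 1" "({1..n+1} - {s}) \<inter> {p<..q} = {}"
    have "?F * b \<in> PIdl\<^bsub>poly_ring n\<^esub> ?f" if b: "b \<in> PIdl\<^bsub>poly_ring n\<^esub> g" for b
    proof -
      obtain r where r: "r \<in> pols n" "b = r * g" using b unfolding PI by auto
      have "?F * b = r * ?f" unfolding r(2) f by (rule mult.left_commute)
      then show ?thesis unfolding PI using r(1) by (intro CollectI exI conjI)
    qed
    then show "minor n p q \<in> ?C" using full_gap_singleton[OF pq] F by (auto simp: colon_ideal_def)
  qed simp
  ultimately show ?thesis using C by (metis subset_antisym)
qed

text \<open>
The minors \<open>[s - 1, s]\<close> and \<open>[s, s + 1]\<close> vanish either where column \<open>s\<close> is zero or where the three columns are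
all parallel; the colon ideal by \<open>[s - 1, s + 1]\<close> removes the second component.
\<close>

lemma knutson_column:
  assumes n: "n \<ge> 1" and s: "s \<in> {1..n}"
  shows "(config_prime n ({1..n} - {s}) {1..n+1} :: 'k::idom pol set) \<in> knutson_ideals (poly_ring n) (knutson_poly n)"
proof -
  let ?K = "knutson_ideals (poly_ring n) (knutson_poly n :: 'k pol)"
  let ?A = "config_prime n {1..n} ({1..n+1} - {s}) :: 'k pol set"
  let ?B = "config_prime n {1..n} ({1..n+1} - {Suc s}) :: 'k pol set"
  let ?N = "config_prime n ({1..n} - {s}) {1..n+1} :: 'k pol set"
  let ?g = "minor n (s - 1) (Suc s) :: 'k pol"
  have g: "?g \<in> pols n" using s by (intro minor_pols) auto
  have PI: "PIdl\<^bsub>poly_ring n\<^esub> ?g = {r * ?g | r. r \<in> pols n}" by (simp add: cgenideal_def)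
  have gI: "?g \<in> PIdl\<^bsub>poly_ring n\<^esub> ?g" unfolding PI by (auto intro!: exI[of _ 1])
  have vN: "config n ({1..n} - {s}) {1..n+1}" by (auto simp: config_def)
  have "\<exists>L\<in>?K. (\<forall>I\<in>{?A, ?B}. I \<subseteq> L) \<and> (\<forall>M. ideal M (poly_ring n) \<longrightarrow> (\<forall>I\<in>{?A, ?B}. I \<subseteq> M) \<longrightarrow> L \<subseteq> M)"
    using knutson_adjacent[OF n, where ?'k='k] s by (intro knutson_family_sum[OF n]) auto
  then obtain L where L: "L \<in> ?K" "?A \<subseteq> L" "?B \<subseteq> L"
    "\<And>M. ideal M (poly_ring n) \<Longrightarrow> ?A \<subseteq> M \<Longrightarrow> ?B \<subseteq> M \<Longrightarrow> L \<subseteq> M" by auto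
  note iL = knutson_pols_ideal[OF n L(1)]
  let ?C = "colon_ideal (poly_ring n) L (PIdl\<^bsub>poly_ring n\<^esub> ?g)"
  have C: "?C \<in> ?K"
    by (rule knutson_ideals.colon[OF L(1) cring.cgenideal_ideal[OF cring_poly_ring g]])
  have inC: "a \<in> ?C" if "a \<in> pols n" "a * ?g \<in> L" for a
    unfolding colon_ideal_def PI using that ideal_pols(5)[OF iL] by (auto simp: mult.left_commute)
  have minor_N: "minor n p q \<in> ?N" if "p < q" "q \<le> n + 1" "p = s \<or> q = s" for p q
    using that s param_minor_zero[OF vN that(1,2)] by (auto simp: config_prime_def intro!: minor_pols)
  have gap_N: "config_prime n {1..n} ({1..n+1} - {t}) \<subseteq> ?N" if t: "t = s \<or> t = Suc s" for t
  proof (rule config_prime_generated[OF config_prime_ideal config_single_gap[OF n]])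
    fix p q assume pq: "p < q" "q \<le> n + 1" "({1..n+1} - {t}) \<inter> {p<..q} = {}"
    then show "minor n p q \<in> ?N"
      using full_gap_singleton[OF pq] t by (intro minor_N) auto
  qed simp
  then have "L \<subseteq> ?N" by (intro L(4) config_prime_ideal) simp_all
  have "?C \<subseteq> ?N"
  proof
    fix a assume "a \<in> ?C"
    then have "a \<in> pols n" "a * ?g \<in> ?N" using gI \<open>L \<subseteq> ?N\<close> by (auto simp: colon_ideal_def)
    moreover have "?g \<notin> ?N" using s by (intro minor_notin_config_prime(2)[OF vN] full_meets) auto
    ultimately show "a \<in> ?N" using config_prime_is_prime g by blast
  qed
  moreover have "?N \<subseteq> ?C"
  proof (rule config_prime_generated[OF knutson_pols_ideal[OF n C] vN])
    fix t assume "t \<in> {1..n} - ({1..n} - {s})"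
    then have t: "t = s" by auto
    have "minor n s (Suc s) \<in> L"
      using L(3) minor_in_gap[OF n, of "Suc s"] s by auto
    moreover have "minor n s (s - 1) \<in> L"
    proof -
      have "minor n (s - 1) s \<in> L"
        using L(2) minor_in_gap[OF n, of s] s by auto
      then have "0 - minor n (s - 1) s \<in> L" using ideal_pols(2,4)[OF iL] by blast
      then show ?thesis by (simp add: minor_swap[of n s])
    qed
    ultimately have "var (X s) * ?g \<in> L" "var (Y s) * ?g \<in> L"
      using minor_relation_ideal[OF iL, of s "s - 1" "Suc s" 1] s by auto
    then show "var (X t) \<in> ?C \<and> var (Y t) \<in> ?C"
      using s unfolding t by (intro conjI inC var_pols)
  next
    fix p q assume "p < q" "q \<le> n + 1" "{1..n + 1} \<inter> {p<..q} = {}"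
    then show "minor n p q \<in> ?C" using full_meets by blast
  qed
  ultimately show ?thesis using C by (metis subset_antisym)
qed

text \<open>
Join the column \<open>r + 1\<close> to the block of columns \<open>p, ..., r\<close>. If \<open>r\<close> is parallel to both sides, then either all of
the columns are parallel or column \<open>r\<close> is zero; the colon ideal by the ideal of column \<open>r\<close>
removes the second component.
\<close>

lemma knutson_interval:
  assumes n: "n \<ge> 1" and "p < q" "q \<le> n + 1" "p \<noteq> 0 \<or> q \<noteq> n + 1"
  shows "(config_prime n {1..n} ({1..n+1} - {p<..q}) :: 'k::idom pol set) \<in> knutson_ideals (poly_ring n) (knutson_poly n)"
  using assms(2-4)
proof (induction q)
  case 0
  then show ?case by simp
next
  case (Suc r)
  let ?K = "knutson_ideals (poly_ring n) (knutson_poly n :: 'k pol)"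
  show ?case
  proof (cases "p = r")
    case True
    have "{r<..Suc r} = {Suc r}" by auto
    then show ?thesis using knutson_adjacent[OF n, of "Suc r", where ?'k='k] Suc.prems True by simp
  next
    case False
    let ?S = "{1..n+1} - {p<..Suc r}"
    let ?A = "config_prime n {1..n} ({1..n+1} - {p<..r}) :: 'k pol set"
    let ?B = "config_prime n {1..n} ({1..n+1} - {Suc r}) :: 'k pol set"
    let ?N = "config_prime n ({1..n} - {r}) {1..n+1} :: 'k pol set"
    let ?P = "config_prime n {1..n} ?S :: 'k pol set"
    have r: "r \<in> {1..n}" "p < r" using False Suc.prems by auto
    have A: "?A \<in> ?K" using Suc r by auto
    have B: "?B \<in> ?K" using knutson_adjacent[OF n] r by auto
    have vP: "config n {1..n} ?S"
      by (rule config_gap[OF Suc.prems])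
    have vA: "config n {1..n} ({1..n+1} - {p<..r})" using r by (intro config_gap) auto
    have vN: "config n ({1..n} - {r}) {1..n+1}" by (auto simp: config_def)
    have "\<exists>L\<in>?K. (\<forall>I\<in>{?A, ?B}. I \<subseteq> L) \<and> (\<forall>M. ideal M (poly_ring n) \<longrightarrow> (\<forall>I\<in>{?A, ?B}. I \<subseteq> M) \<longrightarrow> L \<subseteq> M)"
      using A B by (intro knutson_family_sum[OF n]) auto
    then obtain L where L: "L \<in> ?K" "?A \<subseteq> L" "?B \<subseteq> L"
      "\<And>M. ideal M (poly_ring n) \<Longrightarrow> ?A \<subseteq> M \<Longrightarrow> ?B \<subseteq> M \<Longrightarrow> L \<subseteq> M" by auto
    note iL = knutson_pols_ideal[OF n L(1)]
    let ?C = "colon_ideal (poly_ring n) L ?N"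
    have C: "?C \<in> ?K" by (rule knutson_ideals.colon[OF L(1) config_prime_ideal])
    have "L \<subseteq> ?P"
      by (intro L(4) config_prime_ideal config_prime_mono[OF vA vP] config_prime_mono[OF config_single_gap[OF n] vP])
        (use r in auto)
    have "?C \<subseteq> ?P"
    proof
      fix a assume a: "a \<in> ?C"
      have vr: "var (X r) \<in> ?N" "var (Y r) \<in> ?N" using r by (auto intro!: var_in_config_prime)
      then have "a \<in> pols n" "a * var (X r) \<in> ?P" "a * var (Y r) \<in> ?P"
        using a \<open>L \<subseteq> ?P\<close> by (auto simp: colon_ideal_def)
      moreover have "var (X r) \<in> (pols n :: 'k pol set)" "var (Y r) \<in> (pols n :: 'k pol set)"
        using vr by (auto simp: config_prime_def)
      moreover have "var (X r) \<notin> ?P \<or> var (Y r) \<notin> ?P"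
      proof -
        have "X r \<notin> vanishing {1..n} ?S \<or> Y r \<notin> vanishing {1..n} ?S"
          using configD(2)[OF vP] r(1) unfolding vanishing_def by auto
        moreover have "Poly_Mapping.single k (1::'k) \<noteq> 0" for k :: "nat \<Rightarrow>\<^sub>0 nat"
          by (metis lookup_single_eq lookup_zero zero_neq_one)
        ultimately show ?thesis by (auto simp: config_prime_def param_var)
      qed
      ultimately show "a \<in> ?P" using config_prime_is_prime by blast
    qed
    moreover have "?P \<subseteq> ?C"
    proof (rule config_prime_generated[OF knutson_pols_ideal[OF n C] vP])
      fix p' q' assume pq: "p' < q'" "q' \<le> n + 1" "?S \<inter> {p'<..q'} = {}"
      have "Suc p' \<in> {1..n+1} \<inter> {p'<..q'}" "q' \<in> {1..n+1} \<inter> {p'<..q'}" using pq(1,2) by auto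
      then have "Suc p' \<in> {p<..Suc r}" "q' \<in> {p<..Suc r}" using pq(3) by blast+
      then have le: "p \<le> p'" "q' \<le> Suc r" by auto
      have M: "minor n p' q' \<in> (pols n :: 'k pol set)" using pq by (intro minor_pols) auto
      have inL: "minor n a b \<in> L" if "a < b" "b \<le> n + 1" "p \<le> a \<and> b \<le> r \<or> a = r \<and> b = Suc r" for a b
        using that(3)
      proof
        assume "p \<le> a \<and> b \<le> r"
        then have "({1..n+1} - {p<..r}) \<inter> {a<..b} = {}" by auto
        then show ?thesis using L(2) minor_in_config_prime[OF vA that(1,2)] by blast
      next
        assume "a = r \<and> b = Suc r"
        then show ?thesis using L(3) minor_in_gap[OF n, of "Suc r"] r by auto
      qed
      have "minor n p' q' * b \<in> L" if b: "b \<in> ?N" for b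
      proof (cases "q' \<le> r \<or> p' = r")
        case True
        then have "minor n p' q' \<in> L" using pq le by (intro inL) auto
        then show ?thesis using ideal_pols(6)[OF iL] b by (auto simp: config_prime_def)
      next
        case False
        then have q': "q' = Suc r" "p' < r" using le pq(1) by auto
        have "?N \<subseteq> {b \<in> pols n. b * minor n p' q' \<in> L}"
        proof (rule config_prime_generated[OF colon_elem_ideal[OF iL M] vN])
          fix t assume "t \<in> {1..n} - ({1..n} - {r})"
          then have t: "t = r" by auto
          have "minor n r q' \<in> L" using q' pq(2) by (intro inL) auto
          moreover have "minor n r p' \<in> L"
          proof -
            have "minor n p' r \<in> L" using q' le r by (intro inL) auto
            then have "0 - minor n p' r \<in> L" using ideal_pols(2,4)[OF iL] by blast
            then show ?thesis by (simp add: minor_swap[of n r])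
          qed
          ultimately have "var (X r) * minor n p' q' \<in> L" "var (Y r) * minor n p' q' \<in> L"
            using minor_relation_ideal[OF iL, of r p' q' 1] r q' pq(2) by auto
          then show "var (X t) \<in> {b \<in> pols n. b * minor n p' q' \<in> L} \<and> var (Y t) \<in> {b \<in> pols n. b * minor n p' q' \<in> L}"
            using r unfolding t by (auto simp: poly_ring_def)
        next
          fix p q assume "p < q" "q \<le> n + 1" "{1..n + 1} \<inter> {p<..q} = {}"
          then show "minor n p q \<in> {b \<in> pols n. b * minor n p' q' \<in> L}" using full_meets by blast
        qed
        then show ?thesis using b by (auto simp: mult.commute)
      qed
      then show "minor n p' q' \<in> ?C" using M by (auto simp: colon_ideal_def)
    qed simp
    ultimately show ?thesis using C by (metis subset_antisym)
  qed
qed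

text \<open>
The prime is the sum of the primes that impose a single vanishing column or a single interval of
parallel columns. The zero ideal is excluded because it is an empty sum of this kind.
\<close>

theorem config_prime_knutson:
  assumes n: "n \<ge> 1" and v: "config n D S" and ne: "D \<noteq> {1..n} \<or> S \<noteq> {1..n+1}"
  shows "(config_prime n D S :: 'k::idom pol set) \<in> knutson_ideals (poly_ring n) (knutson_poly n)"
proof -
  let ?K = "knutson_ideals (poly_ring n) (knutson_poly n :: 'k pol)"
  let ?N = "\<lambda>s. config_prime n ({1..n} - {s}) {1..n+1} :: 'k pol set"
  let ?I = "\<lambda>(p, q). config_prime n {1..n} ({1..n+1} - {p<..q}) :: 'k pol set"
  define G where "G = {(p, q). p < q \<and> q \<le> n + 1 \<and> S \<inter> {p<..q} = {}}"
  define T where "T = ?N ` ({1..n} - D) \<union> ?I ` G"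
  have "G \<subseteq> {..n+1} \<times> {..n+1}" by (auto simp: G_def)
  then have "finite G" by (rule finite_subset) simp
  then have "finite T" unfolding T_def by simp
  have GD: "p < q" "q \<le> n + 1" "S \<inter> {p<..q} = {}" "p \<noteq> 0 \<or> q \<noteq> n + 1" if "(p, q) \<in> G" for p q
  proof -
    have "S \<subseteq> {0<..n+1}" "S \<noteq> {}" using v by (auto simp: config_def)
    then have "S \<inter> {0<..n+1} \<noteq> {}" by blast
    then show "p < q" "q \<le> n + 1" "S \<inter> {p<..q} = {}" "p \<noteq> 0 \<or> q \<noteq> n + 1"
      using that by (auto simp: G_def)
  qed
  have "T \<subseteq> ?K"
  proof
    fix I assume "I \<in> T"
    then consider s where "s \<in> {1..n} - D" "I = ?N s" | p q where "(p, q) \<in> G" "I = ?I (p, q)"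
      by (auto simp: T_def)
    then show "I \<in> ?K"
    proof cases
      case 1
      then show ?thesis using knutson_column[OF n, of s] by simp
    next
      case 2
      then show ?thesis using knutson_interval[OF n GD(1,2,4)[OF 2(1)]] by simp
    qed
  qed
  have "T \<noteq> {}"
  proof (cases "D = {1..n}")
    case False
    then show ?thesis using v by (auto simp: T_def config_def)
  next
    case True
    then obtain t where "t \<in> {1..n+1}" "t \<notin> S" using ne v unfolding config_def by blast
    moreover from this have "{t - 1<..t} = {t}" by auto
    ultimately have "(t - 1, t) \<in> G" by (auto simp: G_def)
    then show ?thesis by (auto simp: T_def)
  qed
  obtain L where L: "L \<in> ?K" "\<And>I. I \<in> T \<Longrightarrow> I \<subseteq> L"
    "\<And>M. ideal M (poly_ring n) \<Longrightarrow> (\<forall>I\<in>T. I \<subseteq> M) \<Longrightarrow> L \<subseteq> M"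
    using knutson_family_sum[OF n \<open>finite T\<close> \<open>T \<noteq> {}\<close> \<open>T \<subseteq> ?K\<close>] by auto
  have vI: "config n {1..n} ({1..n+1} - {p<..q})" if "(p, q) \<in> G" for p q
    by (rule config_gap[OF GD(1,2,4)[OF that]])
  have vN: "config n ({1..n} - {s}) {1..n+1}" for s by (auto simp: config_def)
  have "L \<subseteq> config_prime n D S"
  proof (intro L(3) config_prime_ideal ballI)
    fix I assume "I \<in> T"
    then consider s where "s \<in> {1..n} - D" "I = ?N s" | p q where "(p, q) \<in> G" "I = ?I (p, q)"
      by (auto simp: T_def)
    then show "I \<subseteq> config_prime n D S"
    proof cases
      case 1
      then show ?thesis
        unfolding 1(2) using v by (intro config_prime_mono[OF vN v]) (auto simp: config_def)
    next
      case 2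
      then show ?thesis
        unfolding 2(2) prod.case using v GD(3)[OF 2(1)]
        by (intro config_prime_mono[OF vI[OF 2(1)] v]) (auto simp: config_def)
    qed
  qed
  moreover have "config_prime n D S \<subseteq> L"
  proof (rule config_prime_generated[OF knutson_pols_ideal[OF n L(1)] v])
    fix s assume s: "s \<in> {1..n} - D"
    then have "?N s \<subseteq> L" by (intro L(2)) (auto simp: T_def)
    moreover have "var (X s) \<in> ?N s" "var (Y s) \<in> ?N s" using s by (auto intro!: var_in_config_prime)
    ultimately show "var (X s) \<in> L \<and> var (Y s) \<in> L" by blast
  next
    fix p q assume pq: "p < q" "q \<le> n + 1" "S \<inter> {p<..q} = {}"
    then have G: "(p, q) \<in> G" by (simp add: G_def)
    then have "?I (p, q) \<subseteq> L" by (intro L(2)) (auto simp: T_def)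
    moreover have "minor n p q \<in> ?I (p, q)"
      unfolding prod.case by (rule minor_in_config_prime[OF vI[OF G] pq(1,2)]) blast
    ultimately show "minor n p q \<in> L" by blast
  qed
  ultimately show ?thesis using L(1) by (metis subset_antisym)
qed


section \<open>Weakly closed labelings give Knutson ideals\<close>

definition closed_labeling :: "nat \<Rightarrow> nat set set \<Rightarrow> bool" where
  "closed_labeling n E \<longleftrightarrow> (\<forall>i j k. 1 \<le> i \<and> i < j \<and> j < k \<and> k \<le> n \<longrightarrow> {i, k} \<in> E \<longrightarrow> {i, j} \<in> E \<or> {j, k} \<in> E)"

text \<open>
Induction on the length of the edge. Replacing \<open>i\<close> by \<open>p\<close>, or \<open>k\<close> by \<open>q\<close>, gives a shorter interval that
still contains the jump; if neither of these is an edge, weak closedness applied to \<open>i < p < k\<close> and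
\<open>i < q < k\<close> gives the edges \<open>{i, p}\<close> and \<open>{q, k}\<close> instead. Then the three-term relations express multiples of the
minor \<open>[p, q]\<close> by variables of the columns \<open>i\<close> and \<open>k\<close> through the minors \<open>[i, k]\<close>, \<open>[i, p]\<close> and \<open>[q, k]\<close>, and the remaining
factors of the basis element provide such variables, since \<open>i\<close> and \<open>k\<close> are columns of \<open>m\<close>.
\<close>

lemma basis_elem_in_edge_ideal:
  assumes E: "\<Union>E \<subseteq> {1..n}" and closed_labeling: "closed_labeling n E" and m: "m \<in> mons n"
    and "{i, k} \<in> E" "i < k" "i \<in> cols m" "k \<in> cols m" "(p, q) \<in> jumps n m" "i \<le> p" "q \<le> k"
  shows "basis_elem n m \<in> (binomial_edge_ideal n E :: 'k::comm_ring_1 pol set)"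
  using assms(4-)
proof (induction "k - i" arbitrary: i k rule: less_induct)
  case less
  let ?J = "binomial_edge_ideal n E :: 'k pol set"
  have J: "ideal ?J (poly_ring n)" by (rule edge_ideal(1)[OF E])
  have ik: "i \<in> {1..n}" "k \<in> {1..n}" using less.prems cols_mons[OF m] by auto
  note pq = jumps_D[OF m less.prems(5)]
  have pqn: "p \<in> {1..n}" "q \<in> {1..n}" "p \<in> cols m" "q \<in> cols m"
    using pq(1,3,4) less.prems(6,7) ik by auto
  have edge: "minor n a b \<in> ?J" if "{a, b} \<in> E" for a b
  proof -
    have "a \<in> {1..n}" "b \<in> {1..n}" using that E by blast+
    then show ?thesis using edge_ideal(2)[OF E that] by (simp add: minor_eq_minor2)
  qed
  let ?T = "jumps n m - {(p, q)}" and ?r = "m - jump_lead n m"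
  let ?F = "minor n p q :: 'k pol"
  have F: "?F \<in> pols n" using pqn by (intro minor_pols) auto
  note colon = colon_elem_ideal[OF J F]
  have T: "?T \<subseteq> {..n+1} \<times> {..n+1}" using jumps_bound[OF m] by blast
  note r = rest_mons[OF m]
  have basis_elem: "basis_elem n m = ?F * minors_times n ?T ?r"
    unfolding basis_elem_def by (rule minors_times_remove[OF finite_jumps[OF m] less.prems(5)])
  have fin: "basis_elem n m \<in> ?J" if "minors_times n ?T ?r \<in> {a \<in> pols n. a * ?F \<in> ?J}"
    using that by (simp add: basis_elem mult.commute)
  have cov: "meets_col c ?T ?r" if "c \<in> cols m" "c \<noteq> p" "c \<noteq> q" for c
    using basis_elem_meets_col[OF m that(1)] that(2,3) by (auto simp: meets_col_def)
  show ?case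
  proof (cases "(i < p \<and> {p, k} \<in> E) \<or> (q < k \<and> {i, q} \<in> E)")
    case True
    then show ?thesis
    proof
      assume "i < p \<and> {p, k} \<in> E"
      then show ?thesis using less.hyps[of k p] less.prems pq(1) pqn by auto
    next
      assume "q < k \<and> {i, q} \<in> E"
      then show ?thesis using less.hyps[of q i] less.prems pq(1) pqn by auto
    qed
  next
    case False
    have ip: "{i, p} \<in> E" if "i < p"
      using closed_labeling less.prems False that pq(1) ik unfolding closed_labeling_def
      by (metis atLeastAtMost_iff less_le_trans)
    have qk: "{q, k} \<in> E" if "q < k"
      using closed_labeling less.prems False that pq(1) ik unfolding closed_labeling_def
      by (metis atLeastAtMost_iff le_less_trans)
    consider "i = p" "q = k" | "i < p" "q = k" | "i = p" "q < k" | "i < p" "q < k"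
      using less.prems(6,7) by linarith
    then show ?thesis
    proof cases
      case 1
      then have "?F \<in> ?J" using edge[OF less.prems(1)] by simp
      then show ?thesis unfolding basis_elem using ideal_pols(6)[OF J] minors_times_pols[OF T r] by blast
    next
      case 2
      have "var (X i) * (?F * 1) \<in> ?J" "var (Y i) * (?F * 1) \<in> ?J"
        by (rule minor_relation_ideal[OF J ik(1)];
            use 2 pqn edge[OF less.prems(1)] edge[OF ip] in auto)+
      then show ?thesis
        using cov[OF less.prems(3)] 2 pq(1) ik(1)
        by (intro fin minors_times_in_col[OF colon _ _ ik(1) T r]) (auto simp: var_pols)
    next
      case 3
      have "minor n k i \<in> ?J" "minor n k q \<in> ?J"
        using edge[of k i] edge[of k q] less.prems(1) qk[OF 3(2)] by (simp_all add: insert_commute)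
      then have "var (X k) * (?F * 1) \<in> ?J" "var (Y k) * (?F * 1) \<in> ?J"
        using 3 pqn by (intro minor_relation_ideal[OF J ik(2)]; simp)+
      then show ?thesis
        using cov[OF less.prems(4)] 3 pq(1) ik(2)
        by (intro fin minors_times_in_col[OF colon _ _ ik(2) T r]) (auto simp: var_pols)
    next
      case 4
      have ki: "minor n k i \<in> ?J" "minor n k q \<in> ?J"
        using edge[of k i] edge[of k q] less.prems(1) qk[OF 4(2)] by (simp_all add: insert_commute)
      \<comment> \<open>Two relations in a row: first column k against the pair i, q, then column i against the pair p, q.\<close>
      have iq: "var (X k) * (minor n i q * 1) \<in> ?J" "var (Y k) * (minor n i q * 1) \<in> ?J"
        using ki ik pqn by (intro minor_relation_ideal[OF J ik(2)]; simp)+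
      have two: "var a * (?F * var b) \<in> ?J" if "a \<in> {X i, Y i}" "b \<in> {X k, Y k}" for a b
      proof -
        have b: "var b \<in> (pols n :: 'k pol set)" using that(2) ik by (auto simp: var_pols)
        have "minor n i q * var b \<in> ?J" using iq that(2) by (auto simp: mult.commute)
        moreover have "minor n i p * var b \<in> ?J" by (rule ideal_pols(6)[OF J b edge[OF ip[OF 4(1)]]])
        ultimately show ?thesis
          using minor_relation_ideal[OF J ik(1), of p q "var b"] pqn that(1) by auto
      qed
      have "(i, k) \<notin> jumps n m" using jumps_D(5)[OF m _ pqn(3), of i k] 4 pq(1) by auto
      moreover have "(k, i) \<notin> jumps n m" using jumps_D(1)[OF m, of k i] less.prems(2) by auto
      ultimately show ?thesis
        using cov[OF less.prems(3)] cov[OF less.prems(4)] 4 pq(1) ik two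
        by (intro fin minors_times_in_two_cols[OF colon _ ik _ T r]) (auto simp: var_pols ac_simps)
    qed
  qed
qed

text \<open>
If the largest configuration prime avoiding the basis element does not contain the edge ideal, then
some edge joins two columns of \<open>m\<close> with a jump of \<open>m\<close> between them.
\<close>

lemma edge_ideal_dichotomy:
  assumes E: "\<Union>E \<subseteq> {1..n}" and closed_labeling: "closed_labeling n E" and m: "m \<in> mons n"
  shows "basis_elem n m \<in> (binomial_edge_ideal n E :: 'k::comm_ring_1 pol set) \<or>
    (binomial_edge_ideal n E :: 'k pol set) \<subseteq> config_prime n (cols m) (jump_ends n m)"
proof (rule disjCI)
  let ?P = "config_prime n (cols m) (jump_ends n m) :: 'k pol set"
  note v = config_jump_ends[OF m]
  assume not: "\<not> (binomial_edge_ideal n E :: 'k pol set) \<subseteq> ?P"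
  have "\<exists>a b. {a, b} \<in> E \<and> minor2 a b \<notin> ?P"
  proof (rule ccontr)
    assume "\<not> ?thesis"
    then have "(binomial_edge_ideal n E :: 'k pol set) \<subseteq> ?P"
      by (intro edge_ideal_least[OF config_prime_ideal]) blast
    with not show False by simp
  qed
  then obtain a b where ab: "{a, b} \<in> E" "minor2 a b \<notin> ?P" by blast
  have abn: "a \<in> {1..n}" "b \<in> {1..n}" using ab(1) E by blast+
  have swap: "minor2 b a = - (minor2 a b :: 'k pol)" by (simp add: minor2_def)
  have "\<exists>i k. i < k \<and> {i, k} \<in> E \<and> minor2 i k \<notin> ?P"
  proof (cases a b rule: linorder_cases)
    case less
    then show ?thesis using ab by blast
  next
    case equal
    then have "minor2 a b = (0 :: 'k pol)" by (simp add: minor2_def)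
    then show ?thesis using ab(2) ideal_pols(2)[OF config_prime_ideal] by metis
  next
    case greater
    have "minor2 b a \<notin> ?P"
    proof
      assume "minor2 b a \<in> ?P"
      then have "0 - minor2 b a \<in> ?P" using ideal_pols(2,4)[OF config_prime_ideal] by blast
      then show False using ab(2) swap by simp
    qed
    moreover have "{b, a} \<in> E" using ab(1) by (simp add: insert_commute)
    ultimately show ?thesis using greater by blast
  qed
  then obtain i k where ik: "i < k" "{i, k} \<in> E" "minor2 i k \<notin> ?P" by blast
  have ikn: "i \<in> {1..n}" "k \<in> {1..n}" using ik(2) E by blast+
  then have "param (cols m) (jump_ends n m) (minor n i k :: 'k pol) \<noteq> 0"
    using ik(3) by (simp add: config_prime_def minor_eq_minor2 minor2_in_carrier)
  then have *: "jump_ends n m \<inter> {i<..k} \<noteq> {}" "i \<in> cols m" "k \<in> cols m"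
    using param_minor_zero[OF v ik(1), where ?'a='k] ikn by auto
  then obtain p q where pq: "(p, q) \<in> jumps n m" "i < q" "q \<le> k" by (auto simp: jump_ends_def)
  have "i \<le> p" using jumps_D(5)[OF m pq(1) *(2)] pq(2) by linarith
  show "basis_elem n m \<in> (binomial_edge_ideal n E :: 'k pol set)"
    by (rule basis_elem_in_edge_ideal[OF E closed_labeling m ik(2,1) *(2,3) pq(1) \<open>i \<le> p\<close> pq(3)])
qed

theorem weakly_closed_imp_knutson:
  assumes E: "\<Union>E \<subseteq> {1..n}" and e: "{i, k} \<in> E" "i \<noteq> k" and closed_labeling: "closed_labeling n E"
  shows "(binomial_edge_ideal n E :: 'k::idom pol set) \<in> knutson_ideals (poly_ring n) (knutson_poly n)"
proof -
  let ?J = "binomial_edge_ideal n E :: 'k pol set"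
  have ikn: "i \<in> {1..n}" "k \<in> {1..n}" using e E by blast+
  then have n: "n \<ge> 1" by simp
  define U where "U = {(D, S). config n D S \<and> ?J \<subseteq> config_prime n D S}"
  define T where "T = (\<lambda>(D, S). config_prime n D S :: 'k pol set) ` U"
  have "U \<subseteq> Pow {1..n} \<times> Pow {1..n+1}" by (auto simp: U_def config_def)
  then have "finite U" by (rule finite_subset) simp
  then have "finite T" by (simp add: T_def)
  \<comment> \<open>The zero matrix, so that the family of primes above the edge ideal is not empty.\<close>
  have "({}, {1}) \<in> U"
  proof -
    have v: "config n {} {1}" by (simp add: config_def)
    have "minor2 a b \<in> (config_prime n {} {1} :: 'k pol set)" if "{a, b} \<in> E" for a b
    proof -
      have "a \<in> {1..n}" "b \<in> {1..n}" using that E by blast+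
      then show ?thesis
        by (auto simp: config_prime_def minor2_in_carrier minor2_def param_simps param_var vanishing_def
            intro: minor2_in_carrier[unfolded minor2_def])
    qed
    then have "?J \<subseteq> config_prime n {} {1}" by (rule edge_ideal_least[OF config_prime_ideal])
    then show ?thesis using v by (simp add: U_def)
  qed
  then have "T \<noteq> {}" by (auto simp: T_def)
  have "D \<noteq> {1..n} \<or> S \<noteq> {1..n+1}" if "?J \<subseteq> config_prime n D S" for D S
  proof (rule ccontr)
    assume "\<not> ?thesis"
    then have "?J \<subseteq> {0}" using that config_prime_full_zero by auto
    moreover have "minor2 (min i k) (max i k) \<in> ?J"
      using edge_ideal(2)[OF E, of "min i k" "max i k"] e by (auto simp: min_def max_def insert_commute)
    moreover have "minor n (min i k) (max i k) = (minor2 (min i k) (max i k) :: 'k pol)"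
      using ikn by (intro minor_eq_minor2) (auto simp: min_def max_def)
    moreover have "param {1..n} {1..n+1} (minor n (min i k) (max i k) :: 'k pol) \<noteq> 0"
      using ikn e(2) full_meets by (intro minor_notin_config_prime) (auto simp: config_def min_def max_def)
    ultimately show False by (auto simp: param_simps)
  qed
  then have "T \<subseteq> knutson_ideals (poly_ring n) (knutson_poly n)"
    using config_prime_knutson[OF n] by (auto simp: T_def U_def)
  then have K: "\<Inter>T \<in> knutson_ideals (poly_ring n) (knutson_poly n)"
    by (rule knutson_family_inter[OF \<open>finite T\<close> \<open>T \<noteq> {}\<close>])
  have "\<Inter>T = ?J"
  proof
    show "?J \<subseteq> \<Inter>T" by (auto simp: T_def U_def)
    show "\<Inter>T \<subseteq> ?J"
    proof (rule subsetI, rule ccontr)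
      fix a assume a: "a \<in> \<Inter>T" "a \<notin> ?J"
      have "a \<in> pols n" using a(1) \<open>({}, {1}) \<in> U\<close> by (force simp: T_def config_prime_def)
      from basis_elem_witness[OF edge_ideal(1)[OF E] this a(2)] obtain m where m: "m \<in> mons n" "basis_elem n m \<notin> ?J"
        "\<And>D S. config n D S \<Longrightarrow> basis_elem n m \<notin> (config_prime n D S :: 'k pol set) \<Longrightarrow> a \<notin> config_prime n D S" by blast
      note v = config_jump_ends[OF m(1)]
      have "?J \<subseteq> config_prime n (cols m) (jump_ends n m)"
        using edge_ideal_dichotomy[OF E closed_labeling m(1), where ?'k='k] m(2) by blast
      then have "config_prime n (cols m) (jump_ends n m) \<in> T" using v by (force simp: T_def U_def)
      moreover have "a \<notin> config_prime n (cols m) (jump_ends n m)"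
        using m(3)[OF v] basis_elem_in_config_prime_iff[OF v m(1)] compatible_self[OF m(1)] by blast
      ultimately show False using a(1) by blast
    qed
  qed
  then show ?thesis using K by simp
qed

theorem mainTheorem1:
  fixes V :: "'v set" and E :: "'v set set" and n :: nat
  assumes "simple_graph V E" and "card V = n" and "E \<noteq> {}"
  shows "weakly_closed V E \<longleftrightarrow>
    (\<exists>l. labeling V l \<and>
      (binomial_edge_ideal n (labeled_edges l E) :: 'k::field pol set)
        \<in> knutson_ideals (poly_ring n) (knutson_poly n))"
proof -
  have "closed_labeling n (labeled_edges l E) \<longleftrightarrow> (binomial_edge_ideal n (labeled_edges l E) :: 'k pol set)
        \<in> knutson_ideals (poly_ring n) (knutson_poly n)" if l: "labeling V l" for l
  proof
    let ?E = "labeled_edges l E"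
    have bij: "bij_betw l V {1..n}" using l assms(2) by (simp add: labeling_def)
    have edges: "e \<subseteq> V" "card e = 2" if "e \<in> E" for e
      using assms(1) that by (auto simp: simple_graph_def)
    have sub: "\<Union>?E \<subseteq> {1..n}"
      using edges(1) bij by (auto simp: labeled_edges_def bij_betw_def)
    show "(binomial_edge_ideal n ?E :: 'k pol set) \<in> knutson_ideals (poly_ring n) (knutson_poly n)"
      if closed_labeling: "closed_labeling n ?E"
    proof -
      obtain e where e: "e \<in> E" using assms(3) by blast
      then obtain a b where ab: "e = {a, b}" "a \<noteq> b" using edges(2) card_2_iff by metis
      then have "l a \<noteq> l b" using bij edges(1)[OF e] by (auto simp: bij_betw_def inj_on_def)
      moreover have "{l a, l b} \<in> ?E" using e ab by (auto simp: labeled_edges_def image_iff intro!: bexI[of _ e])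
      ultimately show ?thesis using weakly_closed_imp_knutson[OF sub _ _ closed_labeling] by blast
    qed
    show "closed_labeling n ?E"
      if "(binomial_edge_ideal n ?E :: 'k pol set) \<in> knutson_ideals (poly_ring n) (knutson_poly n)"
      using knutson_imp_weakly_closed[OF sub that] unfolding closed_labeling_def by blast
  qed
  then show ?thesis
    unfolding weakly_closed_def closed_labeling_def assms(2) by blast
qed

end
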